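(* Let $(\mathbf{B},\|\cdot\|)$ be a real separable Banach space. Let $\{a_n;\, n\ge 1\}$ and $\{b_n;\, n\ge 1\}$ be increasing sequences of positive real numbers such that $\lim_{n\to\infty} a_n=\infty$ and $\{b_n/a_n;\, n\ge 1\}$ is a nondecreasing sequence. Suppose that, for every symmetric sequence $\{X,X_n;\, n\ge1\}$ of i.i.d. $\mathbf{B}$-valued random variables, with $S_n=\sum_{i=1}^n X_i$, $$\lim_{n\to\infty}\frac{S_n}{a_n}=0\ \text{ a.s.}\quad\text{if and only if}\quad \sum_{n=1}^\infty \mathbb{P}(\|X\|>a_n)<\infty .$$ Then, for every sequence $\{X,X_n;\, n\ge1\}$ of i.i.d. $\mathbf{B}$-valued random variables (not necessarily symmetric), with $S_n=\sum_{i=1}^nX_i$ and $\gamma_n=n\,\mathbb{E}\left(X I\{\|X\|\le b_n\}\right)$, $n\ge1$: (a) if $\sum_{n=1}^\infty\mathbb{P}(\|X\|>b_n)<\infty$, then $\lim_{n\to\infty}\dfrac{S_n-\gamma_n}{b_n}=0$ a.s.; (b) if $\sum_{n=1}^\infty\mathbb{P}(\|X\|>b_n)=\infty$, then $\limsup_{n\to\infty}\dfrac{\|S_n-\gamma_n\|}{b_n}=\infty$ a.s.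
   Context: A $\mathbf{B}$-valued random variable is a Borel measurable map from a probability space $(\Omega,\mathcal{F},\mathbb{P})$ into $\mathbf{B}$. A sequence $\{X,X_n;\,n\ge1\}$ of i.i.d. $\mathbf{B}$-valued random variables means that the $X_n$ are independent and each has the same distribution as $X$; it is called symmetric if $X$ and $-X$ have the same distribution. "a.s." means almost surely, $I\{\cdot\}$ is the indicator function, and the expectation of a $\mathbf{B}$-valued random variable is the Bochner integral. "Increasing" means strictly increasing (as opposed to "nondecreasing"). *)

theory Defs
  imports "HOL-Probability.Probability"
begin

text \<open>Separable Banach spaces are types of class \<^class>\<open>banach\<close> and
  \<^class>\<open>second_countable_topology\<close>. Sequences are indexed by
  \<open>n \<ge> 1\<close>; the value at index 0 of a \<^typ>\<open>nat\<close>-indexed function is never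
  constrained and never matters.\<close>

text \<open>As usual for \<open>{X, X\<^sub>n}\<close>, independence is required of the \<open>X\<^sub>n\<close> only; \<open>X\<close> is a
  random variable on the same space with the common distribution, not assumed independent of
  the \<open>X\<^sub>n\<close>. Measurability of the \<open>X\<^sub>n\<close> is part of \<open>indep_vars\<close>.\<close>

definition iid_sequence ::
  "'w measure \<Rightarrow> ('w \<Rightarrow> 'b::{banach, second_countable_topology}) \<Rightarrow> (nat \<Rightarrow> 'w \<Rightarrow> 'b) \<Rightarrow> bool"
  where "iid_sequence M X Xs \<longleftrightarrow>
    prob_space M \<and>
    X \<in> borel_measurable M \<and>
    prob_space.indep_vars M (\<lambda>_. borel) Xs {1..} \<and>
    (\<forall>n\<ge>1. distr M borel (Xs n) = distr M borel X)"

definition symmetric_rv ::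
  "'w measure \<Rightarrow> ('w \<Rightarrow> 'b::{banach, second_countable_topology}) \<Rightarrow> bool"
  where "symmetric_rv M X \<longleftrightarrow> distr M borel X = distr M borel (\<lambda>\<omega>. - X \<omega>)"

definition partial_sum :: "(nat \<Rightarrow> 'w \<Rightarrow> 'b::real_normed_vector) \<Rightarrow> nat \<Rightarrow> 'w \<Rightarrow> 'b"
  where "partial_sum Xs n \<omega> = (\<Sum>i=1..n. Xs i \<omega>)"

text \<open>The shift by \<^const>\<open>Suc\<close> makes the series start at \<open>n = 1\<close>; the value lies in
  \<open>[0, \<infinity>]\<close>.\<close>

definition tail_series ::
  "'w measure \<Rightarrow> ('w \<Rightarrow> 'b::real_normed_vector) \<Rightarrow> (nat \<Rightarrow> real) \<Rightarrow> ennreal"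
  where "tail_series M X c = (\<Sum>n. emeasure M {\<omega> \<in> space M. norm (X \<omega>) > c (Suc n)})"

definition centering ::
  "'w measure \<Rightarrow> ('w \<Rightarrow> 'b::{banach, second_countable_topology}) \<Rightarrow> (nat \<Rightarrow> real) \<Rightarrow> nat \<Rightarrow> 'b"
  where "centering M X b n =
    real n *\<^sub>R (\<integral>\<omega>. indicator {\<omega>. norm (X \<omega>) \<le> b n} \<omega> *\<^sub>R X \<omega> \<partial>M)"

text \<open>Quantification over all probability spaces would have to range over all sample types, which
  is not possible inside a formula. The property below is used as an assumption and asks for the
  equivalence only on probability spaces over the sequence type \<^typ>\<open>nat \<Rightarrow> 'b\<close>, which
  makes that assumption formally weakest. Nothing is lost: the equivalence depends only on the
  distribution of \<open>X\<close>, and the coordinates on the countable product of that distribution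
  realise the sequence over this type.\<close>

definition symmetric_strong_law ::
  "'b::{banach, second_countable_topology} itself \<Rightarrow> (nat \<Rightarrow> real) \<Rightarrow> bool"
  where "symmetric_strong_law TYPE('b) a \<longleftrightarrow>
    (\<forall>(M :: (nat \<Rightarrow> 'b) measure) (X :: (nat \<Rightarrow> 'b) \<Rightarrow> 'b) Xs.
      iid_sequence M X Xs \<and> symmetric_rv M X \<longrightarrow>
        ((AE \<omega> in M. (\<lambda>n. partial_sum Xs n \<omega> /\<^sub>R a n) \<longlonglongrightarrow> 0) \<longleftrightarrow> tail_series M X a < \<infinity>))"

end

theory Submission imports Defs begin

text \<open>
  Write \<open>d\<^sub>n = c\<^sub>n a\<^sub>n\<close> with \<open>c\<^sub>n\<close> nondecreasing. For symmetric \<open>X\<close> with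
  \<open>\<Sum> P(\<parallel>X\<parallel> > d\<^sub>n) < \<infinity>\<close>, let \<open>\<tau>\<close> be the first index with \<open>\<parallel>X\<parallel> \<le> d\<^sub>\<tau>\<close>. The hypothesis
  applies to \<open>Y = X / c\<^sub>\<tau>\<close>, and eventually \<open>X\<^sub>i = c\<^sub>i \<lambda>\<^sub>i Y\<^sub>i\<close> with \<open>0 \<le> \<lambda>\<^sub>i \<le> 1\<close> a function of
  \<open>X\<^sub>i\<close>. It also applies to \<open>\<eta>\<^sub>i Y\<^sub>i\<close> for independent random signs \<open>\<eta>\<^sub>i\<close> of conditional mean \<open>\<lambda>\<^sub>i\<close>;
  averaging over the signs gives \<open>\<Sum>\<^bsub>i\<le>n\<^esub> \<lambda>\<^sub>i Y\<^sub>i = o(a\<^sub>n)\<close>, and summation by parts gives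
  \<open>\<Sum>\<^bsub>i\<le>n\<^esub> X\<^sub>i = o(d\<^sub>n)\<close>. Averaging is legitimate because for independent summands bounded by a
  multiple of \<open>a\<^sub>i\<close> an almost sure \<open>o(a\<^sub>n)\<close> bound on the sums passes to their means.

  For (a), symmetrize, apply this with \<open>d = 2b\<close>, and average over the independent copy in the same
  way; the truncation levels \<open>b\<^sub>i\<close> are then replaced by \<open>b\<^sub>n\<close> by dominated convergence. For (b), if
  \<open>\<Sum> P(\<parallel>X - X'\<parallel> > K b\<^sub>n) < \<infinity>\<close> for some \<open>K\<close>, then the symmetric law with \<open>d = K b\<close> makes
  \<open>\<parallel>X\<^sub>n - X'\<^sub>n\<parallel> = o(b\<^sub>n)\<close>, hence \<open>\<Sum> P(\<parallel>X\<parallel> > b\<^sub>n) < \<infinity>\<close>. So otherwise the symmetrized increments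
  are not \<open>O(b\<^sub>n)\<close>, while they would be on \<open>E \<times> E\<close>, where \<open>E\<close> is the event that
  \<open>\<parallel>S\<^sub>n - \<gamma>\<^sub>n\<parallel> = O(b\<^sub>n)\<close>; thus \<open>E\<close> is null.
\<close>

section \<open>Borel--Cantelli lemmas and independent sequences\<close>

text \<open>Second Borel-Cantelli lemma. By independence, the probability that none of the events
  with index in \<open>{k..m}\<close> occurs is a product of factors \<open>1 - p n\<close>, each at
  most \<open>exp (- p n)\<close>. Divergence of the series makes this product arbitrarily
  small.\<close>

lemma (in prob_space) borel_cantelli_second:
  fixes N :: "nat \<Rightarrow> 'c measure"
  assumes ind: "indep_vars N X UNIV"
    and P: "\<And>n. {x \<in> space (N n). P n x} \<in> sets (N n)"
    and inf: "(\<Sum>n. emeasure M {\<omega> \<in> space M. P n (X n \<omega>)}) = \<infinity>"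
  shows "AE \<omega> in M. \<exists>\<^sub>F n in sequentially. P n (X n \<omega>)"
proof -
  define p where "p n = prob {\<omega> \<in> space M. P n (X n \<omega>)}" for n
  have rv: "X n \<in> measurable M (N n)" for n
    using ind by (auto simp: indep_vars_def)
  have PX[measurable]: "{\<omega> \<in> space M. P n (X n \<omega>)} \<in> sets M" for n
  proof -
    have "{\<omega> \<in> space M. P n (X n \<omega>)} = X n -` {x \<in> space (N n). P n x} \<inter> space M"
      using measurable_space[OF rv] by auto
    then show ?thesis using rv P by (simp add: measurable_sets)
  qed
  have "\<not> summable p"
  proof
    assume "summable p"
    then have "(\<Sum>n. ennreal (p n)) = ennreal (suminf p)"
      by (rule suminf_ennreal2[rotated]) (simp add: p_def)
    then show False using inf by (simp add: p_def[symmetric] emeasure_eq_measure)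
  qed
  have unbounded: "\<exists>m. K < (\<Sum>i\<in>{k..m}. p i)" for k K
  proof (rule ccontr)
    assume *: "\<nexists>m. K < (\<Sum>i\<in>{k..m}. p i)"
    have "(\<Sum>i<m. p i) \<le> (\<Sum>i<k. p i) + K" for m
    proof -
      have "(\<Sum>i<m. p i) \<le> (\<Sum>i\<in>{..<k} \<union> {k..m}. p i)"
        by (rule sum_mono2) (auto simp: p_def)
      also have "\<dots> = (\<Sum>i<k. p i) + (\<Sum>i\<in>{k..m}. p i)"
        by (rule sum.union_disjoint) auto
      finally show ?thesis using * by (smt (verit))
    qed
    then have "summable p"
      by (intro summableI_nonneg_bounded) (auto simp: p_def)
    with \<open>\<not> summable p\<close> show False by simp
  qed
  have indc: "indep_events (\<lambda>n. {\<omega>\<in>space M. \<not> P n (X n \<omega>)}) UNIV"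
    by (rule indep_eventsI_indep_vars[OF ind]) (intro sets.sets_Collect_neg P)
  have "AE \<omega> in M. \<exists>n\<ge>k. P n (X n \<omega>)" for k
  proof -
    define B where "B = {\<omega> \<in> space M. \<forall>n\<ge>k. \<not> P n (X n \<omega>)}"
    have [measurable]: "B \<in> sets M" unfolding B_def by measurable
    have le: "prob B \<le> exp (- K)" for K
    proof -
      \<comment> \<open>The maximum with 0 makes the block \<open>{k..m}\<close> nonempty, as the
        product rule for independent events is stated for nonempty index sets.\<close>
      obtain m where m: "max K 0 < (\<Sum>i\<in>{k..m}. p i)" using unbounded by blast
      then have ne: "{k..m} \<noteq> {}" by (metis max.cobounded2 not_le sum.empty)
      have "prob B \<le> prob (\<Inter>n\<in>{k..m}. {\<omega>\<in>space M. \<not> P n (X n \<omega>)})"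
        using ne by (intro finite_measure_mono sets.finite_INT) (auto simp: B_def)
      also have "\<dots> = (\<Prod>n\<in>{k..m}. prob {\<omega>\<in>space M. \<not> P n (X n \<omega>)})"
        using indc ne unfolding indep_events_def by auto
      also have "\<dots> = (\<Prod>n\<in>{k..m}. 1 - p n)"
        unfolding p_def by (intro prod.cong refl prob_neg) (use PX in simp)
      also have "\<dots> \<le> (\<Prod>n\<in>{k..m}. exp (- p n))"
      proof (intro prod_mono conjI)
        show "0 \<le> 1 - p i" for i by (simp add: p_def)
        show "1 - p i \<le> exp (- p i)" for i using exp_ge_add_one_self[of "- p i"] by simp
      qed
      also have "\<dots> = exp (- (\<Sum>n\<in>{k..m}. p n))" by (simp add: exp_sum sum_negf[symmetric])
      also have "\<dots> \<le> exp (- K)" using m by simp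
      finally show ?thesis .
    qed
    have "prob B = 0"
    proof (rule ccontr)
      assume "prob B \<noteq> 0"
      then have "prob B > 0" by (simp add: order.strict_iff_order)
      \<comment> \<open>This choice of \<open>K\<close> turns the bound into
        \<open>prob B <= prob B / 2\<close>.\<close>
      with le[of "- ln (prob B / 2)"] show False by simp
    qed
    then have "AE \<omega> in M. \<omega> \<notin> B" by (subst prob_eq_0[symmetric]) auto
    with AE_space show ?thesis by eventually_elim (auto simp: B_def)
  qed
  then have "AE \<omega> in M. \<forall>k. \<exists>n\<ge>k. P n (X n \<omega>)" by (simp add: AE_all_countable)
  then show ?thesis by (simp add: frequently_sequentially)
qed

text \<open>Used to pass between families indexed from 1 and families indexed from 0. Injectivity
  ensures that no variable is listed twice, so the product over \<open>J\<close> is the product over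
  its image.\<close>

lemma (in prob_space) indep_vars_reindex_inj:
  assumes f: "inj_on f I" and ind: "indep_vars N X (f ` I)"
  shows "indep_vars (\<lambda>i. N (f i)) (\<lambda>i. X (f i)) I"
  unfolding indep_vars_def2
proof (intro conjI ballI)
  show "X (f i) \<in> measurable M (N (f i))" if "i \<in> I" for i
    using ind that by (auto simp: indep_vars_def2)
  have sets: "indep_sets (\<lambda>i. {X i -` A \<inter> space M | A. A \<in> sets (N i)}) (f ` I)"
    using ind by (simp add: indep_vars_def2)
  show "indep_sets (\<lambda>i. {X (f i) -` A \<inter> space M | A. A \<in> sets (N (f i))}) I"
  proof (rule indep_setsI)
    show "{X (f i) -` A \<inter> space M | A. A \<in> sets (N (f i))} \<subseteq> events" if "i \<in> I" for i
      using sets that unfolding indep_sets_def by auto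
    fix A J assume J: "J \<noteq> {}" "J \<subseteq> I" "finite J"
      and A: "\<forall>j\<in>J. A j \<in> {X (f j) -` A \<inter> space M | A. A \<in> sets (N (f j))}"
    define g where "g = the_inv_into J f"
    have inj: "inj_on f J" using f J by (blast intro: inj_on_subset)
    have g: "g (f j) = j" if "j \<in> J" for j using the_inv_into_f_f[OF inj that] by (simp add: g_def)
    have "prob (\<Inter>k\<in>f ` J. A (g k)) = (\<Prod>k\<in>f ` J. prob (A (g k)))"
      using sets by (rule indep_setsD) (use J A g in auto)
    then show "prob (\<Inter>j\<in>J. A j) = (\<Prod>j\<in>J. prob (A j))"
      using inj by (simp add: prod.reindex g cong: INF_cong_simp prod.cong_simp)
  qed
qed

lemma (in prob_space) indep_vars_Suc:
  assumes "indep_vars N X {1..}"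
  shows "indep_vars (\<lambda>n. N (Suc n)) (\<lambda>n. X (Suc n)) UNIV"
proof -
  have "indep_vars N X (Suc ` UNIV)" using assms by (rule indep_vars_subset) auto
  from indep_vars_reindex_inj[OF _ this] show ?thesis by simp
qed

lemma emeasure_norm_gt_cong:
  fixes X :: "'w \<Rightarrow> 'b::{banach, second_countable_topology}"
  assumes law: "distr M borel X = distr N borel Y"
    and [measurable]: "X \<in> borel_measurable M" "Y \<in> borel_measurable N"
  shows "emeasure M {\<omega> \<in> space M. norm (X \<omega>) > t} = emeasure N {\<omega> \<in> space N. norm (Y \<omega>) > t}"
proof -
  have "emeasure M {\<omega> \<in> space M. norm (X \<omega>) > t} = emeasure (distr M borel X) {x. norm x > t}"
    by (subst emeasure_distr) (auto intro!: arg_cong[where f="emeasure M"])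
  also have "\<dots> = emeasure N {\<omega> \<in> space N. norm (Y \<omega>) > t}"
    unfolding law by (subst emeasure_distr) (auto intro!: arg_cong[where f="emeasure N"])
  finally show ?thesis .
qed

text \<open>First Borel-Cantelli lemma; equality of laws identifies the series for \<open>X\<close>
  with the series for the \<open>Xs\<close>. It is what makes truncation at level \<open>c i\<close>
  change only finitely many summands.\<close>

lemma (in prob_space) AE_eventually_tail_series:
  fixes X :: "'a \<Rightarrow> 'b::{banach, second_countable_topology}"
  assumes rv: "\<And>i. 1 \<le> i \<Longrightarrow> Xs i \<in> borel_measurable M"
    and law: "\<And>i. 1 \<le> i \<Longrightarrow> distr M borel (Xs i) = distr M borel X"
    and X[measurable]: "X \<in> borel_measurable M"
    and fin: "tail_series M X c < \<infinity>"
  shows "AE \<omega> in M. eventually (\<lambda>i. norm (Xs i \<omega>) \<le> c i) sequentially"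
proof -
  define A where "A n = {\<omega> \<in> space M. norm (Xs (Suc n) \<omega>) > c (Suc n)}" for n
  have [measurable]: "Xs (Suc n) \<in> borel_measurable M" for n using rv by simp
  have [measurable]: "A n \<in> sets M" for n unfolding A_def by measurable
  have eq: "emeasure M (A n) = emeasure M {\<omega> \<in> space M. norm (X \<omega>) > c (Suc n)}" for n
    unfolding A_def by (rule emeasure_norm_gt_cong) (use law in auto)
  have "(\<Sum>n. ennreal (prob (A n))) \<noteq> top"
    using fin eq by (simp add: tail_series_def emeasure_eq_measure less_top)
  then have "summable (\<lambda>n. prob (A n))" by (intro summable_suminf_not_top) auto
  then have "AE \<omega> in M. eventually (\<lambda>n. \<omega> \<in> space M - A n) sequentially"
    by (intro borel_cantelli_AE1) (auto simp: emeasure_eq_measure)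
  then show ?thesis
  proof eventually_elim
    case (elim \<omega>)
    then have "eventually (\<lambda>n. norm (Xs (Suc n) \<omega>) \<le> c (Suc n)) sequentially"
      by (rule eventually_mono) (auto simp: A_def)
    then show ?case by (simp add: eventually_sequentially_Suc[of "\<lambda>i. norm (Xs i \<omega>) \<le> c i"])
  qed
qed

lemma iid_sequence_compose:
  assumes iid: "iid_sequence M X Xs" and f[measurable]: "f \<in> borel_measurable borel"
  shows "iid_sequence M (\<lambda>\<omega>. f (X \<omega>)) (\<lambda>i \<omega>. f (Xs i \<omega>))"
proof -
  interpret prob_space M using iid by (simp add: iid_sequence_def)
  have X[measurable]: "X \<in> borel_measurable M" using iid by (simp add: iid_sequence_def)
  have ind: "indep_vars (\<lambda>_. borel) Xs {1..}" using iid by (simp add: iid_sequence_def)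
  have "distr M borel (\<lambda>\<omega>. f (Xs i \<omega>)) = distr M borel (\<lambda>\<omega>. f (X \<omega>))" if "1 \<le> i" for i
  proof -
    have [measurable]: "Xs i \<in> borel_measurable M" using ind that by (auto simp: indep_vars_def)
    have "distr M borel (\<lambda>\<omega>. f (Xs i \<omega>)) = distr (distr M borel (Xs i)) borel f"
      by (simp add: distr_distr comp_def)
    also have "\<dots> = distr (distr M borel X) borel f"
      using iid that by (simp add: iid_sequence_def)
    finally show ?thesis by (simp add: distr_distr comp_def)
  qed
  then show ?thesis using ind
    by (auto simp: iid_sequence_def prob_space_axioms intro: indep_vars_compose2)
qed

text \<open>Exchanging two almost-sure quantifiers on a product space requires a measurable event.
  Testing convergence against the accuracies \<open>1 / Suc k\<close> leaves only countable
  quantifiers.\<close>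

lemma sets_Collect_partial_sum_tendsto_0:
  fixes V :: "nat \<Rightarrow> 'w \<Rightarrow> 'b::{banach, second_countable_topology}"
  assumes V: "\<And>i. 1 \<le> i \<Longrightarrow> V i \<in> borel_measurable N"
  shows "{\<omega> \<in> space N. (\<lambda>n. partial_sum V n \<omega> /\<^sub>R a n) \<longlonglongrightarrow> 0} \<in> sets N"
proof -
  have [measurable]: "(\<lambda>\<omega>. partial_sum V n \<omega>) \<in> borel_measurable N" for n
    unfolding partial_sum_def by (intro borel_measurable_sum) (use V in auto)
  have "(\<lambda>n. partial_sum V n \<omega> /\<^sub>R a n) \<longlonglongrightarrow> 0 \<longleftrightarrow>
      (\<forall>k::nat. \<exists>m. \<forall>n\<ge>m. norm (partial_sum V n \<omega> /\<^sub>R a n) < 1 / real (Suc k))" for \<omega>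
  proof
    assume "(\<lambda>n. partial_sum V n \<omega> /\<^sub>R a n) \<longlonglongrightarrow> 0"
    then show "\<forall>k::nat. \<exists>m. \<forall>n\<ge>m. norm (partial_sum V n \<omega> /\<^sub>R a n) < 1 / real (Suc k)"
      by (simp only: LIMSEQ_iff diff_0_right) (auto simp del: norm_scaleR)
  next
    assume *: "\<forall>k::nat. \<exists>m. \<forall>n\<ge>m. norm (partial_sum V n \<omega> /\<^sub>R a n) < 1 / real (Suc k)"
    show "(\<lambda>n. partial_sum V n \<omega> /\<^sub>R a n) \<longlonglongrightarrow> 0"
      unfolding LIMSEQ_iff diff_0_right
    proof (intro allI impI)
      fix r :: real assume "0 < r"
      then obtain k where "1 / real (Suc k) < r" using nat_approx_posE by metis
      with * show "\<exists>no. \<forall>n\<ge>no. norm (partial_sum V n \<omega> /\<^sub>R a n) < r"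
        by (meson less_trans)
    qed
  qed
  then show ?thesis by measurable
qed

section \<open>Passage from the canonical sequence space to arbitrary sample spaces\<close>

text \<open>The joint law of the coordinates is the product measure itself and each coordinate
  \<open>i\<close> has law \<open>M i\<close>; a joint law equal to the product of the marginals
  characterises independence.\<close>

lemma indep_vars_PiM_components:
  assumes "\<And>i. prob_space (M i)" "I \<noteq> {}"
  shows "prob_space.indep_vars (PiM I M) M (\<lambda>i x. x i) I"
proof -
  interpret product_prob_space M I by (rule product_prob_spaceI) (rule assms)
  have "distr (PiM I M) (PiM I M) (\<lambda>x. \<lambda>i\<in>I. x i) = PiM I M"
    by (subst distr_cong[OF refl refl, where g="\<lambda>x. x"]) (auto simp: space_PiM PiE_restrict)
  also have "\<dots> = PiM I (\<lambda>i. distr (PiM I M) (M i) (\<lambda>x. x i))"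
    by (intro PiM_cong refl) (simp add: PiM_component)
  finally show ?thesis
    by (subst indep_vars_iff_distr_eq_PiM') (use assms in auto)
qed

text \<open>The hypothesis speaks only of spaces over \<open>nat => 'b\<close>. The map sending a
  sample point to its sequence of values pushes \<open>M\<close> forward to the infinite product of
  the law of \<open>Z\<close>, whose coordinates realise the sequence there. Almost sure convergence
  is then pulled back along this map.\<close>

lemma symmetric_strong_lawD:
  fixes Z :: "'w \<Rightarrow> 'b::{banach, second_countable_topology}"
  assumes law: "symmetric_strong_law TYPE('b) a"
    and iid: "iid_sequence M Z Zs" and sym: "symmetric_rv M Z" and fin: "tail_series M Z a < \<infinity>"
  shows "AE \<omega> in M. (\<lambda>n. partial_sum Zs n \<omega> /\<^sub>R a n) \<longlonglongrightarrow> 0"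
proof -
  interpret prob_space M using iid by (simp add: iid_sequence_def)
  have Z[measurable]: "Z \<in> borel_measurable M" using iid by (simp add: iid_sequence_def)
  have ind: "indep_vars (\<lambda>_. borel) Zs {1..}" using iid by (simp add: iid_sequence_def)
  have rv[measurable]: "Zs (Suc i) \<in> borel_measurable M" for i
    using ind by (auto simp: indep_vars_def)
  define \<mu> where "\<mu> = distr M borel Z"
  interpret \<mu>: prob_space \<mu> unfolding \<mu>_def by (rule prob_space_distr) simp
  have \<mu>_eq: "distr M borel (Zs (Suc i)) = \<mu>" for i
    using iid by (simp add: iid_sequence_def \<mu>_def)
  define N where "N = (\<Pi>\<^sub>M i\<in>(UNIV::nat set). \<mu>)"
  interpret N: product_prob_space "\<lambda>_::nat. \<mu>" UNIV ..
  have [measurable_cong]: "sets \<mu> = sets borel" by (simp add: \<mu>_def)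
  have sets_N[measurable_cong]: "sets N = sets (\<Pi>\<^sub>M i\<in>(UNIV::nat set). borel)"
    unfolding N_def by (intro sets_PiM_cong) (simp_all add: \<mu>_def)
  have [measurable]: "(\<lambda>\<omega> i. Zs (Suc i) \<omega>) \<in> M \<rightarrow>\<^sub>M (\<Pi>\<^sub>M i\<in>UNIV. borel)"
    by (rule measurable_PiM_single') auto
  have N_eq: "N = distr M (\<Pi>\<^sub>M i\<in>UNIV. borel) (\<lambda>\<omega> i. Zs (Suc i) \<omega>)"
    using indep_vars_Suc[OF ind] indep_vars_iff_distr_eq_PiM[where I=UNIV and M'="\<lambda>_. borel" and X="\<lambda>i. Zs (Suc i)"]
    by (simp add: N_def \<mu>_eq restrict_def)
  have coord[measurable]: "(\<lambda>x. x i) \<in> borel_measurable N" for i :: nat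
    by (subst measurable_cong_sets[OF sets_N refl]) simp
  have law_coord: "distr N borel (\<lambda>x. x i) = \<mu>" for i
    unfolding N_eq by (subst distr_distr) (simp_all add: comp_def \<mu>_eq)
  interpret PN: prob_space N unfolding N_def by unfold_locales
  \<comment> \<open>Sequences start at index 1, coordinates at 0. Truncated subtraction makes
    \<open>C 0\<close> equal to \<open>C 1\<close>; \<open>C 0\<close> serves as the representative
    variable, of which only the common law is required.\<close>
  define C :: "nat \<Rightarrow> (nat \<Rightarrow> 'b) \<Rightarrow> 'b" where "C i x = x (i - 1)" for i x
  have [measurable]: "C i \<in> borel_measurable N" for i unfolding C_def[abs_def] by (rule coord)
  have "PN.indep_vars (\<lambda>_. \<mu>) (\<lambda>i x. x i) (UNIV::nat set)"
    unfolding N_def by (rule indep_vars_PiM_components) (auto intro: \<mu>.prob_space_axioms)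
  moreover have "(\<lambda>x. x) \<in> borel_measurable \<mu>" by (simp add: \<mu>_def)
  ultimately have "PN.indep_vars (\<lambda>_. borel) (\<lambda>i x. x i) (UNIV::nat set)"
    using PN.indep_vars_compose2[where Y="\<lambda>_ x. x" and N="\<lambda>_. borel"] by blast
  then have "PN.indep_vars (\<lambda>_. borel) (\<lambda>i x. x i) ((\<lambda>i. i - 1) ` {1::nat..})"
    by (rule PN.indep_vars_subset) auto
  moreover have "inj_on (\<lambda>i. i - 1) {1::nat..}" by (rule inj_onI) auto
  ultimately have indC: "PN.indep_vars (\<lambda>_. borel) C {1..}"
    unfolding C_def[abs_def] by (rule PN.indep_vars_reindex_inj[rotated])
  have "iid_sequence N (C 0) C"
    using indC by (auto simp: iid_sequence_def law_coord C_def[abs_def] PN.prob_space_axioms)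
  moreover have "symmetric_rv N (C 0)"
  proof -
    have "distr N borel (\<lambda>x. - C 0 x) = distr (distr N borel (C 0)) borel uminus"
      by (subst distr_distr) (simp_all add: C_def[abs_def] comp_def)
    also have "\<dots> = distr M borel (\<lambda>\<omega>. - Z \<omega>)"
      by (simp add: C_def[abs_def] law_coord \<mu>_def distr_distr comp_def)
    also have "\<dots> = \<mu>" using sym by (simp add: symmetric_rv_def \<mu>_def)
    finally show ?thesis by (simp add: symmetric_rv_def C_def[abs_def] law_coord)
  qed
  moreover have "tail_series N (C 0) a = tail_series M Z a"
  proof -
    have "distr N borel (C 0) = distr M borel Z" by (simp add: C_def[abs_def] law_coord \<mu>_def)
    then show ?thesis unfolding tail_series_def by (subst emeasure_norm_gt_cong) auto
  qed
  ultimately have "AE x in N. (\<lambda>n. partial_sum C n x /\<^sub>R a n) \<longlonglongrightarrow> 0"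
    using law fin unfolding symmetric_strong_law_def by auto
  then have "AE x in distr M (\<Pi>\<^sub>M i\<in>UNIV. borel) (\<lambda>\<omega> i. Zs (Suc i) \<omega>). (\<lambda>n. partial_sum C n x /\<^sub>R a n) \<longlonglongrightarrow> 0"
    by (simp only: N_eq[symmetric])
  then have "AE \<omega> in M. (\<lambda>n. partial_sum C n (\<lambda>i. Zs (Suc i) \<omega>) /\<^sub>R a n) \<longlonglongrightarrow> 0"
    by (rule AE_distrD[rotated]) measurable
  moreover have "partial_sum C n (\<lambda>i. Zs (Suc i) \<omega>) = partial_sum Zs n \<omega>" for n \<omega>
    by (auto simp: partial_sum_def C_def intro!: sum.cong)
  ultimately show ?thesis by simp
qed

section \<open>Means of sums of bounded independent vectors\<close>

lemma partial_sum_0 [simp]: "partial_sum V 0 \<omega> = 0"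
  by (simp add: partial_sum_def)

lemma partial_sum_Suc [simp]: "partial_sum V (Suc n) \<omega> = partial_sum V n \<omega> + V (Suc n) \<omega>"
  by (simp add: partial_sum_def)

lemma partial_sum_diff:
  assumes "k \<le> n"
  shows "partial_sum V n \<omega> - partial_sum V k \<omega> = (\<Sum>i\<in>{Suc k..n}. V i \<omega>)"
proof -
  have "{1..n} = {1..k} \<union> {Suc k..n}" using assms by auto
  then have "partial_sum V n \<omega> = partial_sum V k \<omega> + (\<Sum>i\<in>{Suc k..n}. V i \<omega>)"
    unfolding partial_sum_def by (subst sum.union_disjoint[symmetric]) auto
  then show ?thesis by simp
qed

text \<open>A first-exit argument in the style of Hoffmann-Jorgensen. The largest mean norm
  \<open>m\<close> of the partial sums up to \<open>n\<close> satisfies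
  \<open>m <= e + p * (e + L + 2 * m)\<close>, and \<open>p <= 1 / 4\<close> lets the term
  \<open>2 * p * m\<close> be absorbed on the left.\<close>

lemma (in prob_space) expectation_norm_partial_sum_le:
  fixes V :: "nat \<Rightarrow> 'a \<Rightarrow> 'b::{banach, second_countable_topology}"
  assumes ind: "indep_vars (\<lambda>_. borel) V {1..}"
    and bound: "\<And>i \<omega>. 1 \<le> i \<Longrightarrow> i \<le> n \<Longrightarrow> \<omega> \<in> space M \<Longrightarrow> norm (V i \<omega>) \<le> L"
    and e: "0 \<le> e" and L: "0 \<le> L"
    and p: "p = prob {\<omega> \<in> space M. \<exists>k\<le>n. e < norm (partial_sum V k \<omega>)}" "p \<le> 1 / 4"
    and r: "r \<le> n"
  shows "expectation (\<lambda>\<omega>. norm (partial_sum V r \<omega>)) \<le> 2 * (e + p * (e + L))"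
proof -
  define S where "S = partial_sum V"
  have rv[measurable]: "1 \<le> i \<Longrightarrow> V i \<in> borel_measurable M" for i
    using ind by (auto simp: indep_vars_def)
  have S[measurable]: "S k \<in> borel_measurable M" for k
    unfolding S_def partial_sum_def by (intro borel_measurable_sum) auto
  have intV: "integrable M (V i)" if "1 \<le> i" "i \<le> n" for i
    using that bound by (intro integrable_const_bound[where B=L]) auto
  have intS: "integrable M (S k)" if "k \<le> n" for k
    unfolding S_def partial_sum_def using that intV by (intro Bochner_Integration.integrable_sum) auto
  define \<phi> where "\<phi> k = expectation (\<lambda>\<omega>. norm (S k \<omega>))" for k
  \<comment> \<open>An index of maximal mean norm is used because the increments
    \<open>S r - S k\<close> must be bounded uniformly in \<open>k\<close> and
    \<open>r\<close>.\<close>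
  obtain k0 where k0: "k0 \<le> n" "\<And>k. k \<le> n \<Longrightarrow> \<phi> k \<le> \<phi> k0"
  proof -
    have "Max (\<phi> ` {..n}) \<in> \<phi> ` {..n}" by (rule Max_in) auto
    then obtain k0 where k0: "k0 \<in> {..n}" "Max (\<phi> ` {..n}) = \<phi> k0" by (rule imageE)
    then have "\<phi> k \<le> \<phi> k0" if "k \<le> n" for k using that by (subst k0(2)[symmetric]) (intro Max_ge, auto)
    with k0 show thesis by (intro that[of k0]) auto
  qed
  define m where "m = \<phi> k0"
  \<comment> \<open>\<open>T k\<close>: the partial sums leave the ball of radius \<open>e\<close> at time \<open>k\<close>, hence by at most \<open>L\<close>; the later
    increments are independent of this event and have mean norm at most \<open>2 m\<close>.\<close>
  define T where "T k = {\<omega> \<in> space M. e < norm (S k \<omega>) \<and> (\<forall>j<k. norm (S j \<omega>) \<le> e)}" for k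
  have T[measurable]: "T k \<in> sets M" for k unfolding T_def by measurable
  have disj: "disjoint_family_on T {..r}" for r
    unfolding disjoint_family_on_def T_def by (auto, metis linorder_neqE_nat not_le)
  have sum_T: "(\<Sum>k\<le>r. prob (T k)) \<le> p" if "r \<le> n" for r
  proof -
    have "(\<Sum>k\<le>r. prob (T k)) = prob (\<Union>k\<le>r. T k)"
      using disj by (intro finite_measure_finite_Union[symmetric]) auto
    also have "\<dots> \<le> p" unfolding p
      by (intro finite_measure_mono) (use that in \<open>auto simp: T_def S_def[symmetric] intro: order_trans\<close>)
    finally show ?thesis .
  qed
  have pointwise: "norm (S r \<omega>) \<le> e + (\<Sum>k\<le>r. indicator (T k) \<omega> * (e + L) + indicator (T k) \<omega> * norm (S r \<omega> - S k \<omega>))"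
    if r: "r \<le> n" and \<omega>: "\<omega> \<in> space M" for r \<omega>
  proof (cases "norm (S r \<omega>) \<le> e")
    case True
    then show ?thesis
      using e L by (intro add_increasing2 sum_nonneg) auto
  next
    case False
    define k where "k = (LEAST j. e < norm (S j \<omega>))"
    have k: "e < norm (S k \<omega>)" unfolding k_def by (rule LeastI[of _ r]) (use False in simp)
    have kr: "k \<le> r" unfolding k_def by (rule Least_le) (use False in simp)
    have "\<forall>j<k. norm (S j \<omega>) \<le> e" unfolding k_def by (auto dest: not_less_Least)
    then have Tk: "\<omega> \<in> T k" using k \<omega> by (simp add: T_def)
    \<comment> \<open>The empty sum lies in the ball, so the exit happens by adding a summand, whose
      norm is at most \<open>L\<close>.\<close>
    have "k \<noteq> 0" using k e by (auto simp: S_def intro: ccontr)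
    then obtain l where l: "k = Suc l" using not0_implies_Suc by blast
    have "norm (S k \<omega>) \<le> norm (S l \<omega>) + norm (V k \<omega>)" by (simp add: l S_def norm_triangle_ineq)
    also have "\<dots> \<le> e + L"
      using \<open>\<forall>j<k. norm (S j \<omega>) \<le> e\<close> bound[of k \<omega>] \<omega> kr r l by (intro add_mono) auto
    finally have "norm (S k \<omega>) \<le> e + L" .
    then have "norm (S r \<omega>) \<le> (e + L) + norm (S r \<omega> - S k \<omega>)"
      using norm_triangle_ineq[of "S k \<omega>" "S r \<omega> - S k \<omega>"] by simp
    also have "\<dots> = indicator (T k) \<omega> * (e + L) + indicator (T k) \<omega> * norm (S r \<omega> - S k \<omega>)"
      using Tk by simp
    also have "\<dots> \<le> (\<Sum>k\<le>r. indicator (T k) \<omega> * (e + L) + indicator (T k) \<omega> * norm (S r \<omega> - S k \<omega>))"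
      using kr e L
      by (intro member_le_sum[of k _ "\<lambda>k. indicator (T k) \<omega> * (e + L) + indicator (T k) \<omega> * norm (S r \<omega> - S k \<omega>)"]) auto
    finally show ?thesis using e by simp
  qed
  have factor: "integrable M (\<lambda>\<omega>. indicator (T k) \<omega> * norm (S r \<omega> - S k \<omega>))"
      "expectation (\<lambda>\<omega>. indicator (T k) \<omega> * norm (S r \<omega> - S k \<omega>)) =
        prob (T k) * expectation (\<lambda>\<omega>. norm (S r \<omega> - S k \<omega>))"
    if "k \<le> r" "r \<le> n" for k r
  proof -
    \<comment> \<open>The exit event is a function of the first \<open>k\<close> summands and the
      increment a function of the summands from \<open>Suc k\<close> to \<open>r\<close>. These
      blocks are disjoint, hence the two are independent.\<close>
    define Y1 :: "(nat \<Rightarrow> 'b) \<Rightarrow> real" where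
      "Y1 f = (if e < norm (\<Sum>i=1..k. f i) \<and> (\<forall>j<k. norm (\<Sum>i=1..j. f i) \<le> e) then 1 else 0)" for f
    define Y2 :: "(nat \<Rightarrow> 'b) \<Rightarrow> real" where "Y2 f = norm (\<Sum>i\<in>{Suc k..r}. f i)" for f
    have sum_meas: "(\<lambda>f. \<Sum>i=1..j. f i) \<in> borel_measurable (\<Pi>\<^sub>M i\<in>{1..k}. (borel :: 'b measure))" if "j \<le> k" for j
      using that by (intro borel_measurable_sum measurable_component_singleton) auto
    have Y1: "Y1 \<in> borel_measurable (\<Pi>\<^sub>M i\<in>{1..k}. borel)"
    proof -
      have [measurable]: "(\<lambda>f. \<Sum>i=1..k. f i) \<in> borel_measurable (\<Pi>\<^sub>M i\<in>{1..k}. (borel :: 'b measure))"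
        by (rule sum_meas) simp
      have "Measurable.pred (\<Pi>\<^sub>M i\<in>{1..k}. (borel :: 'b measure)) (\<lambda>f. \<forall>j\<in>{..<k}. norm (\<Sum>i=1..j. f i) \<le> e)"
      proof (rule pred_intros_finite)
        fix j assume "j \<in> {..<k}"
        then have [measurable]: "(\<lambda>f. \<Sum>i=1..j. f i) \<in> borel_measurable (\<Pi>\<^sub>M i\<in>{1..k}. (borel :: 'b measure))"
          by (intro sum_meas) simp
        show "Measurable.pred (\<Pi>\<^sub>M i\<in>{1..k}. (borel :: 'b measure)) (\<lambda>f. norm (\<Sum>i=1..j. f i) \<le> e)"
          by measurable
      qed simp
      then have [measurable]: "Measurable.pred (\<Pi>\<^sub>M i\<in>{1..k}. (borel :: 'b measure)) (\<lambda>f. \<forall>j<k. norm (\<Sum>i=1..j. f i) \<le> e)"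
        by (simp add: Ball_def)
      show ?thesis unfolding Y1_def[abs_def] by measurable
    qed
    have Y2: "Y2 \<in> borel_measurable (\<Pi>\<^sub>M i\<in>{Suc k..r}. borel)"
    proof -
      have [measurable]: "(\<lambda>f. \<Sum>i\<in>{Suc k..r}. f i) \<in> borel_measurable (\<Pi>\<^sub>M i\<in>{Suc k..r}. (borel :: 'b measure))"
        by (intro borel_measurable_sum measurable_component_singleton)
      show ?thesis unfolding Y2_def[abs_def] by measurable
    qed
    define Z where "Z = Y1 \<circ> (\<lambda>\<omega>. \<lambda>i\<in>{1..k}. V i \<omega>)"
    have "indep_var borel Z borel (Y2 \<circ> (\<lambda>\<omega>. \<lambda>i\<in>{Suc k..r}. V i \<omega>))"
      unfolding Z_def using Y1 Y2 by (intro indep_var_compose[OF indep_var_restrict[OF ind]]) auto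
    moreover have "Y2 \<circ> (\<lambda>\<omega>. \<lambda>i\<in>{Suc k..r}. V i \<omega>) = (\<lambda>\<omega>. norm (S r \<omega> - S k \<omega>))"
      using \<open>k \<le> r\<close> by (simp add: fun_eq_iff Y2_def S_def partial_sum_diff)
    ultimately have *: "indep_var borel Z borel (\<lambda>\<omega>. norm (S r \<omega> - S k \<omega>))" by simp
    have eq: "Z \<omega> = indicator (T k) \<omega>" if "\<omega> \<in> space M" for \<omega>
    proof -
      have "(\<Sum>i=1..j. (\<lambda>i\<in>{1..k}. V i \<omega>) i) = S j \<omega>" if "j \<le> k" for j
        unfolding S_def partial_sum_def using that by (intro sum.cong) auto
      then have "Y1 (\<lambda>i\<in>{1..k}. V i \<omega>) = (if e < norm (S k \<omega>) \<and> (\<forall>j<k. norm (S j \<omega>) \<le> e) then 1 else 0)"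
        unfolding Y1_def by (metis less_imp_le order_refl)
      then show ?thesis using that by (simp add: Z_def T_def indicator_def)
    qed
    have int1: "integrable M Z"
      by (subst Bochner_Integration.integrable_cong[OF refl eq]) (auto simp: emeasure_eq_measure)
    have int2: "integrable M (\<lambda>\<omega>. norm (S r \<omega> - S k \<omega>))"
      using that intS by auto
    have "integrable M (\<lambda>\<omega>. Z \<omega> * norm (S r \<omega> - S k \<omega>))"
      by (rule indep_var_integrable[OF * int1 int2])
    then show "integrable M (\<lambda>\<omega>. indicator (T k) \<omega> * norm (S r \<omega> - S k \<omega>))"
      by (subst (asm) Bochner_Integration.integrable_cong[OF refl]) (use eq in auto)
    have "expectation (\<lambda>\<omega>. indicator (T k) \<omega> * norm (S r \<omega> - S k \<omega>)) =
        expectation (\<lambda>\<omega>. Z \<omega> * norm (S r \<omega> - S k \<omega>))"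
      by (intro Bochner_Integration.integral_cong refl) (use eq in auto)
    also have "\<dots> = expectation Z * expectation (\<lambda>\<omega>. norm (S r \<omega> - S k \<omega>))"
      by (rule indep_var_lebesgue_integral[OF * int1 int2])
    also have "expectation Z = expectation (indicator (T k))"
      by (intro Bochner_Integration.integral_cong refl) (use eq in auto)
    finally show "expectation (\<lambda>\<omega>. indicator (T k) \<omega> * norm (S r \<omega> - S k \<omega>)) =
        prob (T k) * expectation (\<lambda>\<omega>. norm (S r \<omega> - S k \<omega>))"
      by (simp add: T_def)
  qed
  have main: "\<phi> r \<le> e + p * (e + L + 2 * m)" if r: "r \<le> n" for r
  proof -
    define G where "G k \<omega> = indicator (T k) \<omega> * (e + L) + indicator (T k) \<omega> * norm (S r \<omega> - S k \<omega>)" for k \<omega>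
    have intT: "integrable M (\<lambda>\<omega>. indicator (T k) \<omega> * (e + L))" for k
      by (intro integrable_mult_left integrable_real_indicator) (auto simp: emeasure_eq_measure)
    have intG: "integrable M (G k)" if "k \<le> r" for k
      unfolding G_def using factor(1)[OF that r] intT by (intro Bochner_Integration.integrable_add)
    have EG: "expectation (G k) = prob (T k) * (e + L) + prob (T k) * expectation (\<lambda>\<omega>. norm (S r \<omega> - S k \<omega>))"
      if "k \<le> r" for k
      unfolding G_def using factor[OF that r] intT by (subst Bochner_Integration.integral_add) simp_all
    have intsum: "integrable M (\<lambda>\<omega>. \<Sum>k\<le>r. G k \<omega>)"
      using intG by (intro Bochner_Integration.integrable_sum) auto
    have "\<phi> r \<le> expectation (\<lambda>\<omega>. e + (\<Sum>k\<le>r. G k \<omega>))"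
      unfolding \<phi>_def using r intS pointwise intsum by (intro integral_mono) (auto simp: G_def)
    also have "\<dots> = e + expectation (\<lambda>\<omega>. \<Sum>k\<le>r. G k \<omega>)"
      using intsum by (subst Bochner_Integration.integral_add) (auto simp: prob_space)
    also have "expectation (\<lambda>\<omega>. \<Sum>k\<le>r. G k \<omega>) = (\<Sum>k\<le>r. expectation (G k))"
      using intG by (intro Bochner_Integration.integral_sum) auto
    also have "\<dots> = (\<Sum>k\<le>r. prob (T k) * (e + L) + prob (T k) * expectation (\<lambda>\<omega>. norm (S r \<omega> - S k \<omega>)))"
      by (intro sum.cong refl EG) simp
    also have "e + \<dots> \<le> e + (\<Sum>k\<le>r. prob (T k) * (e + L) + prob (T k) * (2 * m))"
    proof (intro add_left_mono sum_mono mult_left_mono)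
      fix k assume "k \<in> {..r}"
      then have k: "k \<le> n" using r by auto
      have "expectation (\<lambda>\<omega>. norm (S r \<omega> - S k \<omega>)) \<le> expectation (\<lambda>\<omega>. norm (S r \<omega>) + norm (S k \<omega>))"
        using intS k r by (intro integral_mono norm_triangle_ineq4) auto
      also have "\<dots> = \<phi> r + \<phi> k" using intS k r by (simp add: \<phi>_def)
      also have "\<dots> \<le> 2 * m" using k0(2)[OF k] k0(2)[OF r] by (simp add: m_def)
      finally show "expectation (\<lambda>\<omega>. norm (S r \<omega> - S k \<omega>)) \<le> 2 * m" .
    qed auto
    also have "\<dots> = e + (\<Sum>k\<le>r. prob (T k)) * (e + L + 2 * m)"
      by (simp only: sum_distrib_right add_left_cancel) (intro sum.cong refl, simp add: algebra_simps)
    also have "\<dots> \<le> e + p * (e + L + 2 * m)"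
    proof (intro add_left_mono mult_right_mono sum_T r)
      have "0 \<le> m" by (simp add: m_def \<phi>_def)
      then show "0 \<le> e + L + 2 * m" using e L by simp
    qed
    finally show ?thesis .
  qed
  have "m \<ge> 0" by (simp add: m_def \<phi>_def)
  then have "p * m \<le> m / 4" using mult_right_mono[OF p(2), of m] by simp
  moreover have "m \<le> e + p * (e + L) + 2 * (p * m)"
    using main[OF k0(1)] by (simp add: m_def algebra_simps)
  ultimately have "m \<le> 2 * (e + p * (e + L))" by simp
  with k0(2)[OF r] show ?thesis by (simp add: m_def \<phi>_def S_def)
qed

text \<open>For late \<open>k\<close> the bound at \<open>k\<close> passes to \<open>n\<close> by
  monotonicity of \<open>c\<close>; the finitely many early terms have a fixed total
  \<open>C\<close>, which \<open>e * c n\<close> eventually exceeds.\<close>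

lemma tendsto_imp_eventually_max_le:
  fixes s :: "nat \<Rightarrow> 'b::real_normed_vector"
  assumes lim: "(\<lambda>n. s n /\<^sub>R c n) \<longlonglongrightarrow> 0" and e: "0 < e"
    and pos: "\<forall>n\<ge>1. 0 < c n" and mono: "mono_on {1..} c" and c: "filterlim c at_top sequentially"
  shows "eventually (\<lambda>n. \<forall>k\<le>n. norm (s k) \<le> e * c n) sequentially"
proof -
  have "eventually (\<lambda>n. norm (s n /\<^sub>R c n) < e) sequentially"
    using tendstoD[OF lim e] by (simp add: dist_norm)
  then obtain m where m: "\<And>n. m \<le> n \<Longrightarrow> norm (s n /\<^sub>R c n) < e"
    by (auto simp: eventually_sequentially)
  define C where "C = (\<Sum>k\<le>m. norm (s k))"
  have "eventually (\<lambda>n. C / e \<le> c n) sequentially" using c by (simp add: filterlim_at_top)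
  moreover have "eventually (\<lambda>n. max 1 m \<le> n) sequentially" by (rule eventually_ge_at_top)
  ultimately show ?thesis
  proof eventually_elim
    case (elim n)
    show ?case
    proof (intro allI impI)
      fix k assume k: "k \<le> n"
      show "norm (s k) \<le> e * c n"
      proof (cases "max 1 m \<le> k")
        case True
        then have ck: "0 < c k" using pos by auto
        have "norm (s k) / c k < e" using m[of k] True ck by (simp add: divide_inverse mult.commute)
        then have "norm (s k) \<le> e * c k" using ck by (simp add: field_simps)
        also have "\<dots> \<le> e * c n" using mono k True e by (auto simp: mono_on_def)
        finally show ?thesis .
      next
        case False
        show ?thesis
        proof (cases "k \<le> m")
          case True
          have "norm (s k) \<le> C" unfolding C_def
            using True by (intro member_le_sum[of k _ "\<lambda>k. norm (s k)"]) auto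
          then show ?thesis using elim e by (simp add: field_simps)
        next
          case 2: False
          with False have "k = 0" "m = 0" by auto
          then show ?thesis using 2 by auto
        qed
      qed
    qed
  qed
qed

text \<open>The almost sure limit controls the running maximum, so the probability of leaving the
  ball of radius \<open>e * c n\<close> tends to 0 by dominated convergence. The preceding
  inequality with \<open>L = K * c n\<close> then bounds the mean norm by a small multiple of
  \<open>c n\<close>.\<close>

lemma (in prob_space) expectation_partial_sum_tendsto_0:
  fixes V :: "nat \<Rightarrow> 'a \<Rightarrow> 'b::{banach, second_countable_topology}"
  assumes ind: "indep_vars (\<lambda>_. borel) V {1..}"
    and bound: "\<And>i \<omega>. 1 \<le> i \<Longrightarrow> \<omega> \<in> space M \<Longrightarrow> norm (V i \<omega>) \<le> K * c i"
    and pos: "\<forall>n\<ge>1. 0 < c n" and mono: "mono_on {1..} c" and c: "filterlim c at_top sequentially"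
    and lim: "AE \<omega> in M. (\<lambda>n. partial_sum V n \<omega> /\<^sub>R c n) \<longlonglongrightarrow> 0"
  shows "(\<lambda>n. (\<Sum>i=1..n. expectation (V i)) /\<^sub>R c n) \<longlonglongrightarrow> 0"
proof (rule tendstoI)
  fix \<epsilon> :: real assume \<epsilon>: "0 < \<epsilon>"
  have rv[measurable]: "1 \<le> i \<Longrightarrow> V i \<in> borel_measurable M" for i
    using ind by (auto simp: indep_vars_def)
  have S[measurable]: "partial_sum V k \<in> borel_measurable M" for k
    unfolding partial_sum_def[abs_def] by (intro borel_measurable_sum) auto
  have K: "0 \<le> K"
  proof -
    obtain \<omega> where "\<omega> \<in> space M" using not_empty by auto
    then have "0 \<le> K * c 1" using bound[of 1 \<omega>] by (meson norm_ge_zero order_trans order_refl)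
    then show ?thesis using pos[rule_format, of 1] by (auto simp: zero_le_mult_iff)
  qed
  \<comment> \<open>The final bound is \<open>4 * e * c n\<close>, which has to stay strictly below
    \<open>\<epsilon> * c n\<close>.\<close>
  define e where "e = \<epsilon> / 6"
  have e: "0 < e" using \<epsilon> by (simp add: e_def)
  define B where "B n = {\<omega> \<in> space M. \<exists>k\<le>n. e * c n < norm (partial_sum V k \<omega>)}" for n
  have B[measurable]: "B n \<in> sets M" for n unfolding B_def by measurable
  have "(\<lambda>n. expectation (indicator (B n))) \<longlonglongrightarrow> expectation (\<lambda>_. 0::real)"
  proof (rule integral_dominated_convergence[where w="\<lambda>_. 1"])
    show "AE \<omega> in M. (\<lambda>n. indicator (B n) \<omega>) \<longlonglongrightarrow> (0::real)"
      using lim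
    proof eventually_elim
      case (elim \<omega>)
      have "eventually (\<lambda>n. \<forall>k\<le>n. norm (partial_sum V k \<omega>) \<le> e * c n) sequentially"
        by (rule tendsto_imp_eventually_max_le[OF elim e pos mono c])
      then have "eventually (\<lambda>n. indicator (B n) \<omega> = (0::real)) sequentially"
        by (rule eventually_mono) (auto simp: B_def indicator_def not_less)
      then show ?case by (rule tendsto_eventually)
    qed
  qed auto
  then have pB: "(\<lambda>n. prob (B n)) \<longlonglongrightarrow> 0"
    by (simp add: B_def)
  \<comment> \<open>The first entry is the threshold required by the first-exit inequality. The
    second keeps the term coming from exits below \<open>e * c n\<close>.\<close>
  define \<delta> where "\<delta> = min (1 / 4) (e / (e + K))"
  have \<delta>: "0 < \<delta>" using e K by (simp add: \<delta>_def)
  have "eventually (\<lambda>n. prob (B n) < \<delta>) sequentially"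
    using order_tendstoD(2)[OF pB \<delta>] .
  moreover have "eventually (\<lambda>n. 1 \<le> n) sequentially" by (rule eventually_ge_at_top)
  ultimately show "eventually (\<lambda>n. dist ((\<Sum>i=1..n. expectation (V i)) /\<^sub>R c n) 0 < \<epsilon>) sequentially"
  proof eventually_elim
    case (elim n)
    then have cn: "0 < c n" using pos by auto
    have bnd: "norm (V i \<omega>) \<le> K * c n" if "1 \<le> i" "i \<le> n" "\<omega> \<in> space M" for i \<omega>
    proof -
      have "c i \<le> c n" using mono that by (auto simp: mono_on_def)
      then show ?thesis using bound[OF that(1,3)] K by (meson mult_left_mono order_trans)
    qed
    have intV: "integrable M (V i)" if "1 \<le> i" "i \<le> n" for i
      using that bnd by (intro integrable_const_bound[where B="K * c n"]) auto
    have "norm (\<Sum>i=1..n. expectation (V i)) = norm (expectation (partial_sum V n))"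
      unfolding partial_sum_def[abs_def] using intV by (subst Bochner_Integration.integral_sum) auto
    also have "\<dots> \<le> expectation (\<lambda>\<omega>. norm (partial_sum V n \<omega>))"
      by (rule integral_norm_bound)
    also have "\<dots> \<le> 2 * (e * c n + prob (B n) * (e * c n + K * c n))"
      by (rule expectation_norm_partial_sum_le[OF ind bnd])
        (use e K cn elim in \<open>auto simp: B_def \<delta>_def\<close>)
    also have "prob (B n) * (e * c n + K * c n) \<le> e / (e + K) * (e * c n + K * c n)"
      using elim e K cn by (intro mult_right_mono) (auto simp: \<delta>_def)
    also have "\<dots> = e * c n" using e K by (simp add: field_simps add_pos_nonneg less_imp_neq[symmetric])
    finally have "norm (\<Sum>i=1..n. expectation (V i)) \<le> 4 * e * c n" by simp
    also have "\<dots> < \<epsilon> * c n" using cn \<epsilon> by (simp add: e_def)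
    finally show ?case using cn by (simp add: field_simps dist_norm)
  qed
qed

section \<open>Symmetric sequences and summation by parts\<close>

text \<open>The event on which the sign is flipped is invariant under negation because
  \<open>s\<close> is even, and so is the law of \<open>X\<close>. Substituting \<open>- x\<close>
  on that event undoes the flip, as \<open>g\<close> is odd.\<close>

lemma distr_sign_symmetric:
  fixes g :: "'b \<Rightarrow> 'b::{banach, second_countable_topology}"
  assumes sym: "symmetric_rv M X" and X[measurable]: "X \<in> borel_measurable M"
    and g[measurable]: "g \<in> borel_measurable borel" and odd: "\<And>x. g (- x) = - g x"
    and s[measurable]: "Measurable.pred borel s" and even: "\<And>x. s (- x) = s x"
  shows "distr M borel (\<lambda>\<omega>. if s (X \<omega>) then g (X \<omega>) else - g (X \<omega>)) = distr M borel (\<lambda>\<omega>. g (X \<omega>))"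
proof -
  define \<mu> where "\<mu> = distr M borel X"
  have [measurable_cong]: "sets \<mu> = sets borel" by (simp add: \<mu>_def)
  have \<mu>: "distr \<mu> borel uminus = \<mu>"
    using sym by (simp add: \<mu>_def distr_distr comp_def symmetric_rv_def)
  have sp: "space \<mu> = UNIV" by (simp add: \<mu>_def)
  have "distr \<mu> borel (\<lambda>x. if s x then g x else - g x) = distr \<mu> borel g"
  proof (rule measure_eqI)
    fix A :: "'b set" assume "A \<in> sets (distr \<mu> borel (\<lambda>x. if s x then g x else - g x))"
    then have A[measurable]: "A \<in> sets borel" by simp
    have "emeasure (distr \<mu> borel (\<lambda>x. if s x then g x else - g x)) A
        = emeasure \<mu> ({x. s x \<and> g x \<in> A} \<union> {x. \<not> s x \<and> - g x \<in> A})"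
      by (subst emeasure_distr) (auto simp: sp split: if_splits intro!: arg_cong[where f="emeasure \<mu>"])
    also have "\<dots> = emeasure \<mu> {x. s x \<and> g x \<in> A} + emeasure \<mu> {x. \<not> s x \<and> - g x \<in> A}"
      by (rule plus_emeasure[symmetric]) auto
    also have "emeasure \<mu> {x. \<not> s x \<and> - g x \<in> A} = emeasure (distr \<mu> borel uminus) {x. \<not> s x \<and> - g x \<in> A}"
      by (simp add: \<mu>)
    also have "\<dots> = emeasure \<mu> {x. \<not> s x \<and> g x \<in> A}"
      by (subst emeasure_distr) (auto simp: sp odd even intro!: arg_cong[where f="emeasure \<mu>"])
    also have "emeasure \<mu> {x. s x \<and> g x \<in> A} + \<dots> = emeasure \<mu> ({x. s x \<and> g x \<in> A} \<union> {x. \<not> s x \<and> g x \<in> A})"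
      by (rule plus_emeasure) auto
    also have "\<dots> = emeasure (distr \<mu> borel g) A"
      by (subst emeasure_distr) (auto simp: sp intro!: arg_cong[where f="emeasure \<mu>"])
    finally show "emeasure (distr \<mu> borel (\<lambda>x. if s x then g x else - g x)) A = emeasure (distr \<mu> borel g) A" .
  qed simp
  then show ?thesis by (simp add: \<mu>_def distr_distr comp_def)
qed

lemma symmetric_rv_compose_odd:
  fixes g :: "'b \<Rightarrow> 'b::{banach, second_countable_topology}"
  assumes sym: "symmetric_rv M X" and X[measurable]: "X \<in> borel_measurable M"
    and g[measurable]: "g \<in> borel_measurable borel" and odd: "\<And>x. g (- x) = - g x"
  shows "symmetric_rv M (\<lambda>\<omega>. g (X \<omega>))"
  using distr_sign_symmetric[OF sym X g odd, of "\<lambda>_. False"] by (simp add: symmetric_rv_def)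

text \<open>Signs that vary with \<open>i\<close> and depend on \<open>Xs i\<close> itself, but
  evenly, keep the sequence i.i.d. with the law of \<open>g X\<close>. The symmetric law therefore
  applies to every such choice of signs.\<close>

lemma iid_sequence_sign:
  fixes g :: "'b \<Rightarrow> 'b::{banach, second_countable_topology}"
  assumes iid: "iid_sequence M X Xs" and sym: "symmetric_rv M X"
    and g[measurable]: "g \<in> borel_measurable borel" and odd: "\<And>x. g (- x) = - g x"
    and s[measurable]: "\<And>i. Measurable.pred borel (s i)" and even: "\<And>i x. s i (- x) = s i x"
  shows "iid_sequence M (\<lambda>\<omega>. g (X \<omega>)) (\<lambda>i \<omega>. if s i (Xs i \<omega>) then g (Xs i \<omega>) else - g (Xs i \<omega>))"
proof -
  interpret prob_space M using iid by (simp add: iid_sequence_def)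
  have X[measurable]: "X \<in> borel_measurable M" using iid by (simp add: iid_sequence_def)
  have ind: "indep_vars (\<lambda>_. borel) Xs {1..}" using iid by (simp add: iid_sequence_def)
  have "distr M borel (\<lambda>\<omega>. if s i (Xs i \<omega>) then g (Xs i \<omega>) else - g (Xs i \<omega>)) = distr M borel (\<lambda>\<omega>. g (X \<omega>))"
    if i: "1 \<le> i" for i
  proof -
    have Xi[measurable]: "Xs i \<in> borel_measurable M" using ind that by (auto simp: indep_vars_def)
    have law: "distr M borel (Xs i) = distr M borel X" using iid i by (simp add: iid_sequence_def)
    have "distr M borel (\<lambda>\<omega>. - Xs i \<omega>) = distr (distr M borel (Xs i)) borel uminus"
      by (simp add: distr_distr comp_def)
    also have "\<dots> = distr M borel (\<lambda>\<omega>. - X \<omega>)" by (simp add: law distr_distr comp_def)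
    finally have "symmetric_rv M (Xs i)" using sym law by (simp add: symmetric_rv_def)
    from distr_sign_symmetric[OF this Xi g odd s even]
    have "distr M borel (\<lambda>\<omega>. if s i (Xs i \<omega>) then g (Xs i \<omega>) else - g (Xs i \<omega>)) = distr M borel (\<lambda>\<omega>. g (Xs i \<omega>))" .
    also have "\<dots> = distr M borel (\<lambda>\<omega>. g (X \<omega>))"
      using iid_sequence_compose[OF iid g] i by (simp add: iid_sequence_def)
    finally show ?thesis .
  qed
  moreover have "indep_vars (\<lambda>_. borel) (\<lambda>i \<omega>. if s i (Xs i \<omega>) then g (Xs i \<omega>) else - g (Xs i \<omega>)) {1..}"
    using ind by (rule indep_vars_compose2) measurable
  ultimately show ?thesis by (simp add: iid_sequence_def prob_space_axioms)
qed

text \<open>Summation by parts: the weighted sum differs from \<open>c n\<close> times the plain sum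
  by partial sums multiplied with the increments of \<open>c\<close>, and these increments are
  nonnegative with total at most \<open>c n\<close>.\<close>

lemma norm_sum_scaleR_mono_le:
  fixes t :: "nat \<Rightarrow> 'b::real_normed_vector"
  assumes c: "mono_on {1..} c" "\<forall>n\<ge>1. 0 \<le> c n" and n: "1 \<le> n"
    and B: "\<And>k. k \<le> n \<Longrightarrow> norm (\<Sum>i=1..k. t i) \<le> B"
  shows "norm (\<Sum>i=1..n. c i *\<^sub>R t i) \<le> 2 * c n * B"
proof -
  have B0: "0 \<le> B" using B[of 0] by simp
  have "norm ((\<Sum>i=1..n. c i *\<^sub>R t i) - c n *\<^sub>R (\<Sum>i=1..n. t i)) \<le> c n * B"
    using n B
  proof (induction n rule: dec_induct)
    case base
    then show ?case using c B0 by simp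
  next
    case (step n)
    have le: "c n \<le> c (Suc n)" using c(1) step.hyps by (auto simp: mono_on_def)
    have "(\<Sum>i=1..Suc n. c i *\<^sub>R t i) - c (Suc n) *\<^sub>R (\<Sum>i=1..Suc n. t i)
        = ((\<Sum>i=1..n. c i *\<^sub>R t i) - c n *\<^sub>R (\<Sum>i=1..n. t i)) - (c (Suc n) - c n) *\<^sub>R (\<Sum>i=1..n. t i)"
      by (simp add: algebra_simps)
    also have "norm \<dots> \<le> c n * B + (c (Suc n) - c n) * B"
    proof (rule order_trans[OF norm_triangle_ineq4 add_mono])
      show "norm ((\<Sum>i=1..n. c i *\<^sub>R t i) - c n *\<^sub>R (\<Sum>i=1..n. t i)) \<le> c n * B"
        using step.prems by (intro step.IH) auto
      show "norm ((c (Suc n) - c n) *\<^sub>R (\<Sum>i=1..n. t i)) \<le> (c (Suc n) - c n) * B"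
        using le step.prems[of n] by (simp add: mult_left_mono)
    qed
    finally show ?case by (simp add: algebra_simps)
  qed
  moreover have "norm (c n *\<^sub>R (\<Sum>i=1..n. t i)) \<le> c n * B"
    using c(2) n B[of n] by (simp add: mult_left_mono)
  moreover have "norm (\<Sum>i=1..n. c i *\<^sub>R t i)
      \<le> norm ((\<Sum>i=1..n. c i *\<^sub>R t i) - c n *\<^sub>R (\<Sum>i=1..n. t i)) + norm (c n *\<^sub>R (\<Sum>i=1..n. t i))"
    by (metis norm_triangle_ineq diff_add_cancel)
  ultimately show ?thesis by simp
qed

lemma sum_scaleR_mono_tendsto_0:
  fixes t :: "nat \<Rightarrow> 'b::real_normed_vector"
  assumes a: "\<forall>n\<ge>1. 0 < a n" "mono_on {1..} a" "filterlim a at_top sequentially"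
    and c: "\<forall>n\<ge>1. 0 < c n" "mono_on {1..} c"
    and lim: "(\<lambda>n. (\<Sum>i=1..n. t i) /\<^sub>R a n) \<longlonglongrightarrow> 0"
  shows "(\<lambda>n. (\<Sum>i=1..n. c i *\<^sub>R t i) /\<^sub>R (c n * a n)) \<longlonglongrightarrow> 0"
proof (rule tendstoI)
  fix e :: real assume e: "0 < e"
  \<comment> \<open>One third, because summation by parts doubles the bound and a strict inequality
    is wanted.\<close>
  have "eventually (\<lambda>n. \<forall>k\<le>n. norm (\<Sum>i=1..k. t i) \<le> e / 3 * a n) sequentially"
    using e by (intro tendsto_imp_eventually_max_le[OF lim _ a]) auto
  moreover have "eventually (\<lambda>n. 1 \<le> n) sequentially" by (rule eventually_ge_at_top)
  ultimately show "eventually (\<lambda>n. dist ((\<Sum>i=1..n. c i *\<^sub>R t i) /\<^sub>R (c n * a n)) 0 < e) sequentially"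
  proof eventually_elim
    case (elim n)
    have pos: "0 < c n * a n" using a c elim by auto
    have "norm (\<Sum>i=1..n. c i *\<^sub>R t i) \<le> 2 * c n * (e / 3 * a n)"
      using elim c by (intro norm_sum_scaleR_mono_le) (auto intro: less_imp_le)
    also have "\<dots> < e * (c n * a n)" using e pos by (simp add: algebra_simps)
    finally show ?case using pos by (simp add: dist_norm abs_of_pos field_simps)
  qed
qed

text \<open>The sums eventually differ by the constant vector \<open>C\<close>, which vanishes after
  division by \<open>d n\<close>.\<close>

lemma sum_tendsto_0_cong_eventually:
  fixes x y :: "nat \<Rightarrow> 'b::real_normed_vector"
  assumes ev: "eventually (\<lambda>i. x i = y i) sequentially" and d: "filterlim d at_top sequentially"
    and lim: "(\<lambda>n. (\<Sum>i=1..n. y i) /\<^sub>R d n) \<longlonglongrightarrow> 0"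
  shows "(\<lambda>n. (\<Sum>i=1..n. x i) /\<^sub>R d n) \<longlonglongrightarrow> 0"
proof -
  obtain m where m: "\<And>i. m \<le> i \<Longrightarrow> x i = y i" using ev by (auto simp: eventually_sequentially)
  define C where "C = (\<Sum>i=1..m. x i - y i)"
  have inv: "(\<lambda>n. inverse (d n)) \<longlonglongrightarrow> 0" using d by (rule tendsto_inverse_0_at_top)
  have "(\<lambda>n. inverse (d n) *\<^sub>R C + (\<Sum>i=1..n. y i) /\<^sub>R d n) \<longlonglongrightarrow> 0 *\<^sub>R C + 0"
    by (intro tendsto_add tendsto_scaleR inv lim tendsto_const)
  moreover have "eventually (\<lambda>n. inverse (d n) *\<^sub>R C + (\<Sum>i=1..n. y i) /\<^sub>R d n = (\<Sum>i=1..n. x i) /\<^sub>R d n) sequentially"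
    using eventually_ge_at_top[of m]
  proof eventually_elim
    case (elim n)
    have "C = (\<Sum>i=1..n. x i - y i)" unfolding C_def
      by (rule sum.mono_neutral_left) (use elim m in auto)
    then show ?case by (simp add: sum_subtractf scaleR_add_right[symmetric])
  qed
  ultimately show ?thesis by (simp add: Lim_transform_eventually)
qed

section \<open>The symmetric law for faster growing norming sequences\<close>

text \<open>Comparing a uniform variable with \<open>q\<close> yields a sign that is positive with
  probability \<open>q\<close>. With \<open>q = (1 + l) / 2\<close> the mean sign is
  \<open>l\<close>, so every mean in \<open>[-1, 1]\<close> can be realised.\<close>

lemma integral_random_sign:
  fixes y :: "'b::{banach, second_countable_topology}"
  assumes q: "0 \<le> q" "q \<le> 1"
  shows "(\<integral>t. (if t \<le> q then y else - y) \<partial>uniform_measure lborel {0..1::real}) = (2 * q - 1) *\<^sub>R y"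
proof -
  define U where "U = uniform_measure lborel {0..1::real}"
  interpret U: prob_space U unfolding U_def by (rule prob_space_uniform_measure) simp_all
  have [measurable_cong]: "sets U = sets borel" by (simp add: U_def)
  have "U.prob {..q} = q"
  proof -
    have "{0..1} \<inter> {..q} = {0..q}" using q by auto
    then show ?thesis using q by (simp add: U_def measure_uniform_measure)
  qed
  moreover have "(\<integral>t. (if t \<le> q then y else - y) \<partial>U) = (\<integral>t. (2 * indicator {..q} t - 1) *\<^sub>R y \<partial>U)"
    by (intro Bochner_Integration.integral_cong refl) (auto simp: indicator_def)
  moreover have "(\<integral>t. (2 * indicator {..q} t - 1) *\<^sub>R y \<partial>U) = (\<integral>t. 2 * indicator {..q} t - (1::real) \<partial>U) *\<^sub>R y"
    by (intro integral_scaleR_left Bochner_Integration.integrable_diff integrable_mult_right integrable_real_indicator)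
      (auto simp: U.emeasure_eq_measure)
  moreover have "(\<integral>t. 2 * indicator {..q} t - (1::real) \<partial>U) = 2 * U.prob {..q} - 1"
    by (subst Bochner_Integration.integral_diff)
      (auto simp: U.emeasure_eq_measure U.prob_space intro!: integrable_mult_right integrable_real_indicator)
  ultimately show ?thesis by (simp add: U_def)
qed

text \<open>Multipliers in \<open>[-1, 1]\<close> are obtained as means of random signs. Since
  \<open>lim\<close> holds for every threshold sequence \<open>u\<close>, Fubini gives, for almost
  every \<open>\<omega>\<close>, convergence for almost every \<open>u\<close> drawn with
  independent uniform coordinates. At fixed \<open>\<omega>\<close> the signed terms are independent
  and bounded by a multiple of \<open>a i\<close>, so the convergence passes to their means.\<close>

lemma random_sign_contraction:
  fixes Y :: "nat \<Rightarrow> 'w \<Rightarrow> 'b::{banach, second_countable_topology}" and a :: "nat \<Rightarrow> real"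
  assumes M: "prob_space M"
    and Y: "\<And>i. 1 \<le> i \<Longrightarrow> Y i \<in> borel_measurable M"
    and l: "\<And>i. 1 \<le> i \<Longrightarrow> l i \<in> borel_measurable M" "\<And>i \<omega>. 1 \<le> i \<Longrightarrow> \<bar>l i \<omega>\<bar> \<le> (1::real)"
    and a: "\<forall>n\<ge>1. 0 < a n" "mono_on {1..} a" "filterlim a at_top sequentially"
    and bound: "AE \<omega> in M. eventually (\<lambda>i. norm (Y i \<omega>) \<le> a i) sequentially"
    and lim: "\<And>u. AE \<omega> in M.
      (\<lambda>n. partial_sum (\<lambda>i \<omega>. if u i \<le> (1 + l i \<omega>) / 2 then Y i \<omega> else - Y i \<omega>) n \<omega> /\<^sub>R a n) \<longlonglongrightarrow> 0"
  shows "AE \<omega> in M. (\<lambda>n. (\<Sum>i=1..n. l i \<omega> *\<^sub>R Y i \<omega>) /\<^sub>R a n) \<longlonglongrightarrow> 0"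
proof -
  interpret M: prob_space M by (rule M)
  define U where "U = uniform_measure lborel {0..1::real}"
  interpret U: prob_space U unfolding U_def by (rule prob_space_uniform_measure) simp_all
  define N where "N = (\<Pi>\<^sub>M i\<in>(UNIV::nat set). U)"
  interpret N: product_prob_space "\<lambda>_::nat. U" UNIV ..
  interpret PN: prob_space N unfolding N_def by unfold_locales
  interpret pair_sigma_finite M N ..
  have sets_U: "sets U = sets borel" by (simp add: U_def)
  have coord[measurable]: "(\<lambda>x. x i) \<in> borel_measurable N" for i :: nat
    unfolding N_def using measurable_component_singleton[of i UNIV "\<lambda>_. U"]
    by (simp cong: measurable_cong_sets add: sets_U)
  define W where "W i \<omega> u = (if u i \<le> (1 + l i \<omega>) / 2 then Y i \<omega> else - Y i \<omega>)" for i \<omega> and u :: "nat \<Rightarrow> real"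
  have W: "(\<lambda>z. W i (fst z) (snd z)) \<in> borel_measurable (M \<Otimes>\<^sub>M N)" if "1 \<le> i" for i
  proof -
    have [measurable]: "Y i \<in> borel_measurable M" "l i \<in> borel_measurable M" using Y l that by auto
    show ?thesis unfolding W_def by measurable
  qed
  \<comment> \<open>For each fixed \<open>u\<close> the signs depend on \<open>\<omega>\<close> only; for fixed \<open>\<omega>\<close> they are independent in \<open>u\<close>.\<close>
  have "AE \<omega> in M. AE u in N. (\<lambda>n. partial_sum (\<lambda>i. W i \<omega>) n u /\<^sub>R a n) \<longlonglongrightarrow> 0"
  proof (subst AE_commute)
    show "{z \<in> space (M \<Otimes>\<^sub>M N). (\<lambda>n. partial_sum (\<lambda>i. W i (fst z)) n (snd z) /\<^sub>R a n) \<longlonglongrightarrow> 0} \<in> sets (M \<Otimes>\<^sub>M N)"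
      using sets_Collect_partial_sum_tendsto_0[OF W, where a=a] by (simp add: partial_sum_def)
    show "AE u in N. AE \<omega> in M. (\<lambda>n. partial_sum (\<lambda>i. W i \<omega>) n u /\<^sub>R a n) \<longlonglongrightarrow> 0"
      using lim by (simp add: partial_sum_def W_def)
  qed
  with bound show ?thesis
  proof eventually_elim
    case (elim \<omega>)
    obtain K where K: "\<And>i. 1 \<le> i \<Longrightarrow> norm (Y i \<omega>) \<le> K * a i"
    proof -
      obtain m where m: "\<And>i. m \<le> i \<Longrightarrow> norm (Y i \<omega>) \<le> a i"
        using elim(1) by (auto simp: eventually_sequentially)
      \<comment> \<open>The eventual bound is extended to all indices by adding the ratios at the
        finitely many early ones. Index 0 is switched off, since \<open>a 0\<close> may have any
        sign.\<close>
      define K where "K = 1 + (\<Sum>i\<le>m. norm (Y i \<omega>) / a i * (if 1 \<le> i then 1 else 0))"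
      have nonneg: "0 \<le> norm (Y i \<omega>) / a i * (if 1 \<le> i then 1 else 0)" for i
        using a(1) by (auto intro!: divide_nonneg_pos)
      have K1: "1 \<le> K" unfolding K_def using nonneg by (simp add: sum_nonneg)
      have "norm (Y i \<omega>) \<le> K * a i" if i: "1 \<le> i" for i
      proof (cases "m \<le> i")
        case True
        have "a i \<le> K * a i" using K1 a(1) i by (simp add: mult_right_mono)
        then show ?thesis using m[OF True] by linarith
      next
        case False
        then have "norm (Y i \<omega>) / a i * (if 1 \<le> i then 1 else 0) \<le> K"
          unfolding K_def using nonneg
          by (intro add_increasing member_le_sum[of i _ "\<lambda>i. norm (Y i \<omega>) / a i * (if 1 \<le> i then 1 else 0)"]) auto
        then show ?thesis using i a(1) by (simp add: field_simps)
      qed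
      then show thesis by (rule that)
    qed
    have "PN.indep_vars (\<lambda>_. U) (\<lambda>i x. x i) (UNIV::nat set)"
      unfolding N_def by (rule indep_vars_PiM_components) (auto intro: U.prob_space_axioms)
    then have "PN.indep_vars (\<lambda>_. U) (\<lambda>i x. x i) {1::nat..}"
      by (rule PN.indep_vars_subset) simp
    moreover have sgn[measurable]: "(\<lambda>t. if t \<le> (1 + l i \<omega>) / 2 then Y i \<omega> else - Y i \<omega>) \<in> borel_measurable U" for i
      by (subst measurable_cong_sets[OF sets_U refl]) measurable
    ultimately have "PN.indep_vars (\<lambda>_. borel) (\<lambda>i. W i \<omega>) {1..}"
      unfolding W_def
      by (rule PN.indep_vars_compose2[where Y="\<lambda>i t. if t \<le> (1 + l i \<omega>) / 2 then Y i \<omega> else - Y i \<omega>"])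
    then have "(\<lambda>n. (\<Sum>i=1..n. PN.expectation (W i \<omega>)) /\<^sub>R a n) \<longlonglongrightarrow> 0"
      by (rule PN.expectation_partial_sum_tendsto_0[OF _ _ a elim(2)]) (use K in \<open>auto simp: W_def\<close>)
    moreover have "PN.expectation (W i \<omega>) = l i \<omega> *\<^sub>R Y i \<omega>" if "1 \<le> i" for i
    proof -
      have "PN.expectation (W i \<omega>) = (\<integral>t. (if t \<le> (1 + l i \<omega>) / 2 then Y i \<omega> else - Y i \<omega>) \<partial>distr N U (\<lambda>x. x i))"
        unfolding W_def N_def by (subst integral_distr[OF _ sgn]) auto
      also have "distr N U (\<lambda>x. x i) = U" unfolding N_def by (rule N.PiM_component) simp
      also have "(\<integral>t. (if t \<le> (1 + l i \<omega>) / 2 then Y i \<omega> else - Y i \<omega>) \<partial>U) = (2 * ((1 + l i \<omega>) / 2) - 1) *\<^sub>R Y i \<omega>"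
        unfolding U_def using l(2)[OF that, of \<omega>] by (intro integral_random_sign) (auto simp: abs_le_iff)
      also have "2 * ((1 + l i \<omega>) / 2) - 1 = l i \<omega>" by (simp add: field_simps)
      finally show ?thesis .
    qed
    then have "(\<Sum>i=1..n. PN.expectation (W i \<omega>)) = (\<Sum>i=1..n. l i \<omega> *\<^sub>R Y i \<omega>)" for n
      by (intro sum.cong) auto
    ultimately show ?case by simp
  qed
qed

text \<open>Dividing \<open>x\<close> by \<open>c\<close> at its first admissible level turns the
  bound \<open>d n\<close> into \<open>a n\<close>, so the law for \<open>a\<close> covers the
  rescaled sequence. Undoing the rescaling costs a multiplier in \<open>[0, 1]\<close>, handled by
  random signs, and the monotone weight \<open>c i\<close>, handled by summation by parts.\<close>

lemma symmetric_strong_law_mono: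
  fixes X :: "'w \<Rightarrow> 'b::{banach, second_countable_topology}"
  assumes law: "symmetric_strong_law TYPE('b) a"
    and a: "\<forall>n\<ge>1. 0 < a n" "mono_on {1..} a" "filterlim a at_top sequentially"
    and d: "\<forall>n\<ge>1. 0 < d n" "mono_on {1..} (\<lambda>n. d n / a n)" "filterlim d at_top sequentially"
    and iid: "iid_sequence M X Xs" and sym: "symmetric_rv M X" and fin: "tail_series M X d < \<infinity>"
  shows "AE \<omega> in M. (\<lambda>n. partial_sum Xs n \<omega> /\<^sub>R d n) \<longlonglongrightarrow> 0"
proof -
  interpret prob_space M using iid by (simp add: iid_sequence_def)
  have X[measurable]: "X \<in> borel_measurable M" using iid by (simp add: iid_sequence_def)
  have rv: "Xs i \<in> borel_measurable M" if "1 \<le> i" for i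
    using iid that unfolding iid_sequence_def by (auto simp: indep_vars_def)
  define c where "c n = d n / a n" for n
  have c: "\<forall>n\<ge>1. 0 < c n" "mono_on {1..} c" using a d unfolding c_def[abs_def] by auto
  have ca: "c n * a n = d n" if "1 \<le> n" for n using a(1) that by (simp add: c_def order_less_imp_not_eq2)
  define \<tau> where "\<tau> x = (LEAST n. 1 \<le> n \<and> norm x \<le> d n)" for x :: 'b
  have \<tau>: "1 \<le> \<tau> x \<and> norm x \<le> d (\<tau> x)" for x
  proof -
    have "eventually (\<lambda>n. norm x \<le> d n) sequentially" using d(3) by (simp add: filterlim_at_top)
    then have "eventually (\<lambda>n. 1 \<le> n \<and> norm x \<le> d n) sequentially"
      using eventually_ge_at_top[of 1] by eventually_elim simp
    then have "\<exists>n. 1 \<le> n \<and> norm x \<le> d n" by (rule eventually_happens'[rotated]) simp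
    then show ?thesis unfolding \<tau>_def by (rule LeastI_ex)
  qed
  have \<tau>_le: "\<tau> x \<le> n" if "1 \<le> n" "norm x \<le> d n" for x n
    unfolding \<tau>_def using that by (intro Least_le) simp
  have \<tau>_minus: "\<tau> (- x) = \<tau> x" for x by (simp add: \<tau>_def)
  have [measurable]: "\<tau> \<in> borel \<rightarrow>\<^sub>M count_space UNIV"
    unfolding \<tau>_def[abs_def] by measurable
  define g where "g x = x /\<^sub>R c (\<tau> x)" for x :: 'b
  have g[measurable]: "g \<in> borel_measurable borel" unfolding g_def[abs_def] by measurable
  have g_minus: "g (- x) = - g x" for x by (simp add: g_def \<tau>_minus)
  have g_le: "norm (g x) \<le> a n" if "1 \<le> n" "norm x \<le> d n" for x n
  proof -
    have "norm (g x) = norm x / c (\<tau> x)"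
      using c(1) \<tau>[of x] by (simp add: g_def abs_of_pos divide_inverse mult.commute)
    also have "\<dots> \<le> d (\<tau> x) / c (\<tau> x)" using c(1) \<tau>[of x] by (intro divide_right_mono) (auto intro: less_imp_le)
    also have "\<dots> = a (\<tau> x)" using c(1) \<tau>[of x] by (simp add: ca[symmetric] order_less_imp_not_eq2)
    also have "\<dots> \<le> a n" using a(2) \<tau>[of x] \<tau>_le[OF that] that by (auto simp: mono_on_def)
    finally show ?thesis .
  qed
  \<comment> \<open>The intended multiplier is the ratio, which is at most 1 once
    \<open>\<tau> x <= i\<close>. The minimum keeps it in range at the early indices where this
    fails.\<close>
  define l where "l i x = min 1 (c (\<tau> x) / c i)" for i x
  have [measurable]: "l i \<in> borel_measurable borel" for i unfolding l_def[abs_def] by measurable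
  have l_abs: "\<bar>l i x\<bar> \<le> 1" if "1 \<le> i" for i x
  proof -
    have "0 < c (\<tau> x) / c i" using c(1) \<tau>[of x] that by simp
    then show ?thesis by (simp add: l_def)
  qed
  have fin': "tail_series M (\<lambda>\<omega>. g (X \<omega>)) a < \<infinity>"
  proof -
    have "tail_series M (\<lambda>\<omega>. g (X \<omega>)) a \<le> tail_series M X d"
      \<comment> \<open>By \<open>g_le\<close>, exceeding \<open>a n\<close> after rescaling forces
        \<open>x\<close> to exceed \<open>d n\<close>.\<close>
      unfolding tail_series_def
      by (intro suminf_le emeasure_mono summableI) (auto simp: not_le[symmetric] g_le)
    then show ?thesis using fin by simp
  qed
  have evX: "AE \<omega> in M. eventually (\<lambda>i. norm (Xs i \<omega>) \<le> d i) sequentially"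
    using rv iid fin by (intro AE_eventually_tail_series) (auto simp: iid_sequence_def)
  have "AE \<omega> in M. (\<lambda>n. (\<Sum>i=1..n. l i (Xs i \<omega>) *\<^sub>R g (Xs i \<omega>)) /\<^sub>R a n) \<longlonglongrightarrow> 0"
  proof (rule random_sign_contraction[OF prob_space_axioms _ _ _ a])
    show "(\<lambda>\<omega>. g (Xs i \<omega>)) \<in> borel_measurable M" if "1 \<le> i" for i using rv[OF that] by measurable
    show "(\<lambda>\<omega>. l i (Xs i \<omega>)) \<in> borel_measurable M" if "1 \<le> i" for i
      using rv[OF that] by measurable
    show "\<bar>l i (Xs i \<omega>)\<bar> \<le> 1" if "1 \<le> i" for i \<omega> using that by (rule l_abs)
    show "AE \<omega> in M. eventually (\<lambda>i. norm (g (Xs i \<omega>)) \<le> a i) sequentially"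
      using evX
    proof eventually_elim
      case (elim \<omega>)
      then show ?case using eventually_ge_at_top[of 1] by eventually_elim (rule g_le)
    qed
    fix u :: "nat \<Rightarrow> real"
    \<comment> \<open>The sign depends on \<open>x\<close> only through \<open>\<tau> x\<close>,
      hence only through the norm, so it is even.\<close>
    have "iid_sequence M (\<lambda>\<omega>. g (X \<omega>))
      (\<lambda>i \<omega>. if u i \<le> (1 + l i (Xs i \<omega>)) / 2 then g (Xs i \<omega>) else - g (Xs i \<omega>))"
      by (rule iid_sequence_sign[OF iid sym g g_minus, of "\<lambda>i x. u i \<le> (1 + l i x) / 2"])
        (auto simp: l_def \<tau>_minus)
    then show "AE \<omega> in M. (\<lambda>n. partial_sum (\<lambda>i \<omega>. if u i \<le> (1 + l i (Xs i \<omega>)) / 2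
        then g (Xs i \<omega>) else - g (Xs i \<omega>)) n \<omega> /\<^sub>R a n) \<longlonglongrightarrow> 0"
      using symmetric_rv_compose_odd[OF sym X g g_minus] fin' by (rule symmetric_strong_lawD[OF law])
  qed
  with evX show ?thesis
  proof eventually_elim
    case (elim \<omega>)
    define t where "t i = l i (Xs i \<omega>) *\<^sub>R g (Xs i \<omega>)" for i
    have "(\<lambda>n. (\<Sum>i=1..n. c i *\<^sub>R t i) /\<^sub>R (c n * a n)) \<longlonglongrightarrow> 0"
      using elim(2) by (intro sum_scaleR_mono_tendsto_0[OF a c]) (simp add: t_def)
    moreover have "eventually (\<lambda>n. (\<Sum>i=1..n. c i *\<^sub>R t i) /\<^sub>R (c n * a n) = (\<Sum>i=1..n. c i *\<^sub>R t i) /\<^sub>R d n) sequentially"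
      using eventually_ge_at_top[of 1] by eventually_elim (simp add: ca)
    ultimately have lim: "(\<lambda>n. (\<Sum>i=1..n. c i *\<^sub>R t i) /\<^sub>R d n) \<longlonglongrightarrow> 0"
      by (rule Lim_transform_eventually)
    have ev: "eventually (\<lambda>i. Xs i \<omega> = c i *\<^sub>R t i) sequentially"
      using elim(1) eventually_ge_at_top[of 1]
    proof eventually_elim
      case (elim i)
      have pos: "0 < c i" "0 < c (\<tau> (Xs i \<omega>))" using c(1) elim(2) \<tau>[of "Xs i \<omega>"] by auto
      have "c (\<tau> (Xs i \<omega>)) \<le> c i" using c(2) \<tau> \<tau>_le[OF elim(2,1)] elim by (auto simp: mono_on_def)
      then have "l i (Xs i \<omega>) = c (\<tau> (Xs i \<omega>)) / c i"
        using pos by (simp add: l_def min_def)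
      then show ?case using elim pos by (simp add: t_def g_def)
    qed
    show ?case unfolding partial_sum_def by (rule sum_tendsto_0_cong_eventually[OF ev d(3) lim])
  qed
qed

section \<open>Symmetrization\<close>

text \<open>The independent copy lives on the second factor of the product space, so fixing the
  first coordinate leaves the copy free to be averaged.\<close>

abbreviation symmetrization :: "('w \<Rightarrow> 'b::real_normed_vector) \<Rightarrow> 'w \<times> 'w \<Rightarrow> 'b"
  where "symmetrization f \<equiv> (\<lambda>z. f (fst z) - f (snd z))"

text \<open>For a fixed first coordinate, independence in the second factor splits the section
  probability into factors \<open>h j (Xs j \<omega>)\<close>. These are functions of independent
  variables in the first factor, so the integral of their product splits as well.\<close>

lemma (in prob_space) indep_vars_symmetrization:
  fixes Xs :: "'i \<Rightarrow> 'a \<Rightarrow> 'b::{banach, second_countable_topology}"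
  assumes ind: "indep_vars (\<lambda>_. borel) Xs I"
  shows "prob_space.indep_vars (M \<Otimes>\<^sub>M M) (\<lambda>_. borel) (\<lambda>i. symmetrization (Xs i)) I"
proof -
  interpret PP: pair_prob_space M M ..
  have rv[measurable]: "Xs i \<in> borel_measurable M" if "i \<in> I" for i
    using ind that by (auto simp: indep_vars_def)
  show ?thesis
    unfolding PP.indep_vars_def2
  proof (intro conjI ballI PP.indep_setsI)
    show meas: "symmetrization (Xs i) \<in> borel_measurable (M \<Otimes>\<^sub>M M)" if "i \<in> I" for i
      using rv[OF that] by measurable
    show "{symmetrization (Xs i) -` A \<inter> space (M \<Otimes>\<^sub>M M) |A. A \<in> sets borel} \<subseteq> sets (M \<Otimes>\<^sub>M M)" if "i \<in> I" for i
      using meas[OF that] by (auto intro: measurable_sets)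
    fix B J assume J: "J \<noteq> {}" "J \<subseteq> I" "finite J"
      and "\<forall>j\<in>J. B j \<in> {symmetrization (Xs j) -` A \<inter> space (M \<Otimes>\<^sub>M M) |A. A \<in> sets borel}"
    then obtain A where A: "\<And>j. j \<in> J \<Longrightarrow> A j \<in> sets borel"
      and B: "\<And>j. j \<in> J \<Longrightarrow> B j = symmetrization (Xs j) -` A j \<inter> space (M \<Otimes>\<^sub>M M)"
      by (auto simp: Bex_def) metis
    have B_sets[measurable]: "B j \<in> sets (M \<Otimes>\<^sub>M M)" if "j \<in> J" for j
      using B[OF that] A[OF that] meas[of j] J that by (auto intro!: measurable_sets)
    define h where "h j x = emeasure M {\<omega> \<in> space M. x - Xs j \<omega> \<in> A j}" for j x
    have h[measurable]: "h j \<in> borel_measurable borel" if "j \<in> J" for j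
    proof -
      have [measurable]: "Xs j \<in> borel_measurable M" "A j \<in> sets borel" using that J A rv by auto
      show ?thesis unfolding h_def by measurable
    qed
    have slice: "emeasure (M \<Otimes>\<^sub>M M) (B j) = (\<integral>\<^sup>+\<omega>. h j (Xs j \<omega>) \<partial>M)" if "j \<in> J" for j
      by (subst emeasure_pair_measure_alt[OF B_sets[OF that]])
        (use that in \<open>auto simp: B h_def space_pair_measure intro!: nn_integral_cong arg_cong[where f="emeasure M"]\<close>)
    have "(\<Inter>j\<in>J. B j) \<in> sets (M \<Otimes>\<^sub>M M)" using J B_sets by (intro sets.finite_INT) auto
    then have "emeasure (M \<Otimes>\<^sub>M M) (\<Inter>j\<in>J. B j) = (\<integral>\<^sup>+\<omega>. emeasure M (\<Inter>j\<in>J. (Xs j -` {y. Xs j \<omega> - y \<in> A j} \<inter> space M)) \<partial>M)"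
      using J by (subst emeasure_pair_measure_alt)
        (auto simp: B space_pair_measure intro!: nn_integral_cong arg_cong[where f="emeasure M"])
    also have "\<dots> = (\<integral>\<^sup>+\<omega>. (\<Prod>j\<in>J. h j (Xs j \<omega>)) \<partial>M)"
    proof (intro nn_integral_cong)
      fix \<omega>
      have A': "{y. Xs j \<omega> - y \<in> A j} \<in> sets borel" if "j \<in> J" for j
      proof -
        have [measurable]: "A j \<in> sets borel" using A that .
        show ?thesis by measurable
      qed
      have vimage: "Xs j -` {y. Xs j \<omega> - y \<in> A j} \<inter> space M = {\<omega>' \<in> space M. Xs j \<omega> - Xs j \<omega>' \<in> A j}" for j
        by auto
      have "prob (\<Inter>j\<in>J. (Xs j -` {y. Xs j \<omega> - y \<in> A j} \<inter> space M)) =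
          (\<Prod>j\<in>J. prob (Xs j -` {y. Xs j \<omega> - y \<in> A j} \<inter> space M))"
        using J A' by (intro indep_varsD[OF ind]) auto
      then show "emeasure M (\<Inter>j\<in>J. (Xs j -` {y. Xs j \<omega> - y \<in> A j} \<inter> space M)) = (\<Prod>j\<in>J. h j (Xs j \<omega>))"
        unfolding vimage by (simp only: emeasure_eq_measure h_def prod_ennreal measure_nonneg)
    qed
    also have "\<dots> = (\<Prod>j\<in>J. \<integral>\<^sup>+\<omega>. h j (Xs j \<omega>) \<partial>M)"
    proof (rule indep_vars_nn_integral)
      show "indep_vars (\<lambda>_. borel) (\<lambda>j \<omega>. h j (Xs j \<omega>)) J"
        using indep_vars_subset[OF ind J(2)] h by (rule indep_vars_compose2)
    qed (use J in auto)
    also have "\<dots> = (\<Prod>j\<in>J. emeasure (M \<Otimes>\<^sub>M M) (B j))"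
      by (simp add: slice)
    finally show "measure (M \<Otimes>\<^sub>M M) (\<Inter>j\<in>J. B j) = (\<Prod>j\<in>J. measure (M \<Otimes>\<^sub>M M) (B j))"
      by (simp add: PP.emeasure_eq_measure prod_ennreal prod_nonneg)
  qed
qed

text \<open>The right-hand side involves \<open>f\<close> through its law alone, which makes the
  symmetrized sequence identically distributed.\<close>

lemma (in prob_space) distr_symmetrization:
  fixes f :: "'a \<Rightarrow> 'b::{banach, second_countable_topology}"
  assumes [measurable]: "f \<in> borel_measurable M"
  shows "distr (M \<Otimes>\<^sub>M M) borel (symmetrization f) =
    distr (distr M borel f \<Otimes>\<^sub>M distr M borel f) borel (\<lambda>z. fst z - snd z)"
proof -
  interpret D: prob_space "distr M borel f" by (rule prob_space_distr) simp
  have "distr M borel f \<Otimes>\<^sub>M distr M borel f = distr (M \<Otimes>\<^sub>M M) (borel \<Otimes>\<^sub>M borel) (\<lambda>(x, y). (f x, f y))"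
    by (rule pair_measure_distr) (auto intro: D.sigma_finite_measure_axioms)
  then show ?thesis
    by (simp add: distr_distr comp_def split_beta)
qed

lemma iid_sequence_symmetrization:
  fixes X :: "'w \<Rightarrow> 'b::{banach, second_countable_topology}"
  assumes iid: "iid_sequence M X Xs"
  shows "iid_sequence (M \<Otimes>\<^sub>M M) (symmetrization X) (\<lambda>i. symmetrization (Xs i))"
proof -
  interpret prob_space M using iid by (simp add: iid_sequence_def)
  interpret PP: pair_prob_space M M ..
  have [measurable]: "X \<in> borel_measurable M" using iid by (simp add: iid_sequence_def)
  have ind: "indep_vars (\<lambda>_. borel) Xs {1..}" using iid by (simp add: iid_sequence_def)
  have "distr (M \<Otimes>\<^sub>M M) borel (symmetrization (Xs i)) = distr (M \<Otimes>\<^sub>M M) borel (symmetrization X)" if "1 \<le> i" for i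
  proof -
    have [measurable]: "Xs i \<in> borel_measurable M" using ind that by (auto simp: indep_vars_def)
    have "distr M borel (Xs i) = distr M borel X" using iid that by (simp add: iid_sequence_def)
    then show ?thesis by (simp add: distr_symmetrization)
  qed
  then show ?thesis
    using indep_vars_symmetrization[OF ind] by (simp add: iid_sequence_def PP.prob_space_axioms)
qed

text \<open>Swapping the two factors preserves the product measure and reverses the sign of the
  difference.\<close>

lemma (in prob_space) symmetric_rv_symmetrization:
  fixes X :: "'a \<Rightarrow> 'b::{banach, second_countable_topology}"
  assumes [measurable]: "X \<in> borel_measurable M"
  shows "symmetric_rv (M \<Otimes>\<^sub>M M) (symmetrization X)"
proof -
  interpret PP: pair_prob_space M M ..
  have "distr (M \<Otimes>\<^sub>M M) borel (symmetrization X) =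
      distr (distr (M \<Otimes>\<^sub>M M) (M \<Otimes>\<^sub>M M) (\<lambda>(x, y). (y, x))) borel (symmetrization X)"
    by (subst PP.distr_pair_swap) simp
  also have "\<dots> = distr (M \<Otimes>\<^sub>M M) borel (\<lambda>z. - symmetrization X z)"
    by (subst distr_distr) (auto simp: comp_def split_beta)
  finally show ?thesis by (simp add: symmetric_rv_def)
qed

lemma (in prob_space) tail_series_finite_iff:
  fixes X :: "'a \<Rightarrow> 'b::real_normed_vector"
  shows "tail_series M X c < \<infinity> \<longleftrightarrow> summable (\<lambda>n. prob {\<omega> \<in> space M. norm (X \<omega>) > c (Suc n)})"
proof
  assume "tail_series M X c < \<infinity>"
  then show "summable (\<lambda>n. prob {\<omega> \<in> space M. norm (X \<omega>) > c (Suc n)})"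
    by (intro summable_suminf_not_top) (auto simp: tail_series_def emeasure_eq_measure)
next
  assume "summable (\<lambda>n. prob {\<omega> \<in> space M. norm (X \<omega>) > c (Suc n)})"
  then show "tail_series M X c < \<infinity>"
    by (simp add: tail_series_def emeasure_eq_measure suminf_ennreal2)
qed

lemma (in prob_space) prob_pair_Times:
  assumes "A \<in> sets M" "B \<in> sets M"
  shows "measure (M \<Otimes>\<^sub>M M) (A \<times> B) = prob A * prob B"
proof -
  interpret PP: pair_prob_space M M ..
  show ?thesis using emeasure_pair_measure_Times[OF assms]
    by (simp add: PP.emeasure_eq_measure emeasure_eq_measure ennreal_mult[symmetric])
qed

text \<open>A difference of norm above \<open>2 * b n\<close> forces one of its two terms above
  \<open>b n\<close>; the union bound costs a factor 2.\<close>

lemma (in prob_space) tail_series_symmetrization_finite: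
  fixes X :: "'a \<Rightarrow> 'b::{banach, second_countable_topology}"
  assumes [measurable]: "X \<in> borel_measurable M" and fin: "tail_series M X b < \<infinity>"
  shows "tail_series (M \<Otimes>\<^sub>M M) (symmetrization X) (\<lambda>n. 2 * b n) < \<infinity>"
proof -
  interpret PP: pair_prob_space M M ..
  define A where "A n = {\<omega> \<in> space M. norm (X \<omega>) > b (Suc n)}" for n
  have [measurable]: "A n \<in> sets M" for n unfolding A_def by measurable
  have le: "PP.prob {z \<in> space (M \<Otimes>\<^sub>M M). norm (symmetrization X z) > 2 * b (Suc n)} \<le> 2 * prob (A n)" for n
  proof -
    have "{z \<in> space (M \<Otimes>\<^sub>M M). norm (symmetrization X z) > 2 * b (Suc n)} \<subseteq> A n \<times> space M \<union> space M \<times> A n"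
    proof (safe, simp_all add: space_pair_measure A_def)
      fix x y assume "2 * b (Suc n) < norm (X x - X y)" "\<not> b (Suc n) < norm (X y)"
      then show "b (Suc n) < norm (X x)" using norm_triangle_ineq4[of "X x" "X y"] by linarith
    qed
    then have "PP.prob {z \<in> space (M \<Otimes>\<^sub>M M). norm (symmetrization X z) > 2 * b (Suc n)}
        \<le> PP.prob (A n \<times> space M \<union> space M \<times> A n)"
      by (intro PP.finite_measure_mono) auto
    also have "\<dots> \<le> PP.prob (A n \<times> space M) + PP.prob (space M \<times> A n)"
      by (intro measure_Un_le) auto
    finally show ?thesis by (simp add: prob_pair_Times prob_space)
  qed
  have "summable (\<lambda>n. 2 * prob (A n))"
    using fin unfolding tail_series_finite_iff A_def by (rule summable_mult)
  then show ?thesis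
    unfolding PP.tail_series_finite_iff by (rule summable_comparison_test') (use le in auto)
qed

lemma (in prob_space) prob_norm_gt_tendsto_0:
  fixes X :: "'a \<Rightarrow> 'b::{banach, second_countable_topology}"
  assumes [measurable]: "X \<in> borel_measurable M" and d: "filterlim d at_top sequentially"
  shows "(\<lambda>n. prob {\<omega> \<in> space M. norm (X \<omega>) > d n}) \<longlonglongrightarrow> 0"
proof -
  define A where "A n = {\<omega> \<in> space M. norm (X \<omega>) > d n}" for n
  have [measurable]: "A n \<in> sets M" for n unfolding A_def by measurable
  have "(\<lambda>n. expectation (indicator (A n))) \<longlonglongrightarrow> expectation (\<lambda>_. 0::real)"
  proof (rule integral_dominated_convergence[where w="\<lambda>_. 1"])
    show "AE \<omega> in M. (\<lambda>n. indicator (A n) \<omega>) \<longlonglongrightarrow> (0::real)"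
    proof (intro AE_I2 tendsto_eventually)
      fix \<omega>
      have "eventually (\<lambda>n. norm (X \<omega>) \<le> d n) sequentially" using d by (simp add: filterlim_at_top)
      then show "eventually (\<lambda>n. indicator (A n) \<omega> = (0::real)) sequentially"
        by (rule eventually_mono) (simp add: A_def)
    qed
  qed auto
  then show ?thesis by (simp add: A_def)
qed

text \<open>Weak symmetrization inequality: if \<open>X\<close> exceeds \<open>b n\<close> while its
  copy stays within \<open>b n / 2\<close>, the difference exceeds \<open>b n / 2\<close>. The
  condition on the copy is independent of \<open>X\<close> and eventually has probability at least
  1/2, whence the factor 2.\<close>

lemma (in prob_space) tail_series_finite_of_symmetrization:
  fixes X :: "'a \<Rightarrow> 'b::{banach, second_countable_topology}"
  assumes X[measurable]: "X \<in> borel_measurable M" and b: "filterlim b at_top sequentially"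
    and fin: "tail_series (M \<Otimes>\<^sub>M M) (symmetrization X) (\<lambda>n. b n / 2) < \<infinity>"
  shows "tail_series M X b < \<infinity>"
proof -
  interpret PP: pair_prob_space M M ..
  have b2: "filterlim (\<lambda>n. b (Suc n) / 2) at_top sequentially"
  proof -
    have "filterlim (\<lambda>n. b (Suc n)) at_top sequentially" using b by (subst filterlim_sequentially_Suc)
    from filterlim_tendsto_pos_mult_at_top[OF tendsto_const _ this, of "1/2"] show ?thesis by simp
  qed
  define q where "q n = PP.prob {z \<in> space (M \<Otimes>\<^sub>M M). norm (symmetrization X z) > b (Suc n) / 2}" for n
  have "eventually (\<lambda>n. prob {\<omega> \<in> space M. norm (X \<omega>) > b (Suc n) / 2} < 1 / 2) sequentially"
    using order_tendstoD(2)[OF prob_norm_gt_tendsto_0[OF X b2], of "1/2"] by simp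
  then have "eventually (\<lambda>n. norm (prob {\<omega> \<in> space M. norm (X \<omega>) > b (Suc n)}) \<le> 2 * q n) sequentially"
  proof eventually_elim
    case (elim n)
    let ?A = "{\<omega> \<in> space M. norm (X \<omega>) > b (Suc n)}" and ?B = "{\<omega> \<in> space M. \<not> norm (X \<omega>) > b (Suc n) / 2}"
    have "prob ?B \<ge> 1 / 2" using elim by (subst prob_neg) auto
    then have "prob ?A * (1 / 2) \<le> prob ?A * prob ?B" by (intro mult_left_mono) auto
    also have "\<dots> = PP.prob (?A \<times> ?B)" by (intro prob_pair_Times[symmetric]) measurable
    also have "\<dots> \<le> q n" unfolding q_def
    proof (intro PP.finite_measure_mono, safe, simp_all add: space_pair_measure not_less)
      fix x y assume "b (Suc n) < norm (X x)" "norm (X y) * 2 \<le> b (Suc n)"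
      then show "b (Suc n) < norm (X x - X y) * 2" using norm_triangle_ineq2[of "X x" "X y"] by linarith
    qed
    finally show ?case by simp
  qed
  moreover have "summable (\<lambda>n. 2 * q n)"
    using fin unfolding PP.tail_series_finite_iff q_def by (rule summable_mult)
  ultimately show ?thesis
    unfolding tail_series_finite_iff by (rule summable_comparison_test_ev)
qed

section \<open>Centering\<close>

definition truncate :: "real \<Rightarrow> 'b::real_normed_vector \<Rightarrow> 'b"
  where "truncate t x = (if norm x \<le> t then x else 0)"

lemma borel_measurable_truncate [measurable]:
  "truncate t \<in> borel_measurable (borel :: 'b::{banach, second_countable_topology} measure)"
  unfolding truncate_def[abs_def] by measurable

lemma norm_truncate_le: "0 \<le> t \<Longrightarrow> norm (truncate t x) \<le> t"
  by (simp add: truncate_def)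

lemma (in prob_space) integrable_truncate:
  fixes X :: "'a \<Rightarrow> 'b::{banach, second_countable_topology}"
  assumes [measurable]: "X \<in> borel_measurable M" and t: "0 \<le> t"
  shows "integrable M (\<lambda>\<omega>. truncate t (X \<omega>))"
  by (rule integrable_const_bound[where B=t]) (auto simp: norm_truncate_le t)

lemma centering_eq_truncate:
  "centering M X b n = real n *\<^sub>R (\<integral>\<omega>. truncate (b n) (X \<omega>) \<partial>M)"
  unfolding centering_def
  by (intro arg_cong2[where f="(*\<^sub>R)"] refl Bochner_Integration.integral_cong) (auto simp: truncate_def)

text \<open>For \<open>n >= 1\<close> the expression is the mean of \<open>f n\<close>, which tends
  to 0 pointwise and is dominated by \<open>w\<close>.\<close>

lemma (in prob_space) centering_minus_sum_tendsto_0: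
  fixes X :: "'a \<Rightarrow> 'b::{banach, second_countable_topology}"
  assumes X[measurable]: "X \<in> borel_measurable M"
    and b: "\<forall>n\<ge>1. 0 < b n" "mono_on {1..} b" "filterlim b at_top sequentially"
    and fin: "tail_series M X b < \<infinity>"
  shows "(\<lambda>n. (centering M X b n - (\<Sum>i=1..n. expectation (\<lambda>\<omega>. truncate (b i) (X \<omega>)))) /\<^sub>R b n) \<longlonglongrightarrow> 0"
proof -
  define f where "f n \<omega> = (\<Sum>i=1..n. truncate (b n) (X \<omega>) - truncate (b i) (X \<omega>)) /\<^sub>R b n" for n \<omega>
  have f[measurable]: "f n \<in> borel_measurable M" for n unfolding f_def[abs_def] by measurable
  define A where "A i = {\<omega> \<in> space M. b (Suc i) < norm (X \<omega>)}" for i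
  have A[measurable]: "A i \<in> sets M" for i unfolding A_def by measurable
  \<comment> \<open>The number of levels \<open>b i\<close>, \<open>i >= 1\<close>, exceeded by
    \<open>X\<close>; its mean is the tail series, which is why \<open>w\<close> is
    integrable.\<close>
  define w where "w \<omega> = (\<Sum>i. indicat_real (A i) \<omega>)" for \<omega>
  have ev: "eventually (\<lambda>n. norm (X \<omega>) \<le> b n) sequentially" for \<omega>
    using b(3) by (simp add: filterlim_at_top)
  have ev_Suc: "eventually (\<lambda>i. indicat_real (A i) \<omega> = 0) sequentially" for \<omega>
    using ev[of \<omega>, THEN eventually_sequentially_Suc[THEN iffD2]]
    by (rule eventually_mono) (simp add: A_def)
  have summ: "summable (\<lambda>i. indicat_real (A i) \<omega>)" for \<omega>
  proof -
    obtain m where "\<And>i. m \<le> i \<Longrightarrow> indicat_real (A i) \<omega> = 0"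
      using ev_Suc[of \<omega>] by (auto simp: eventually_sequentially)
    then show ?thesis by (intro summable_finite[of "{..<m}"]) auto
  qed
  have int_w: "integrable M w" unfolding w_def[abs_def]
  proof (rule integrable_suminf)
    show "integrable M (indicat_real (A i))" for i by (intro integrable_real_indicator) (auto simp: emeasure_eq_measure)
    show "AE \<omega> in M. summable (\<lambda>i. norm (indicat_real (A i) \<omega>))" using summ by simp
    show "summable (\<lambda>i. \<integral>\<omega>. norm (indicat_real (A i) \<omega>) \<partial>M)"
      using fin[unfolded tail_series_finite_iff] by (simp add: A_def)
  qed
  have "(\<lambda>n. expectation (f n)) \<longlonglongrightarrow> expectation (\<lambda>_. 0)"
  proof (rule integral_dominated_convergence[OF _ f int_w])
    show "AE \<omega> in M. (\<lambda>n. f n \<omega>) \<longlonglongrightarrow> 0"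
    proof (rule AE_I2)
      fix \<omega>
      \<comment> \<open>Once \<open>b n\<close> reaches the norm of \<open>X\<close>, the truncation
        at \<open>b n\<close> is \<open>X\<close> itself, so \<open>f n\<close> is a sum with only
        finitely many nonzero terms divided by \<open>b n\<close>.\<close>
      have "eventually (\<lambda>i. X \<omega> - truncate (b i) (X \<omega>) = 0) sequentially"
        using ev[of \<omega>] by (rule eventually_mono) (simp add: truncate_def)
      then have "(\<lambda>n. (\<Sum>i=1..n. X \<omega> - truncate (b i) (X \<omega>)) /\<^sub>R b n) \<longlonglongrightarrow> 0"
        by (rule sum_tendsto_0_cong_eventually[OF _ b(3)]) simp
      moreover have "eventually (\<lambda>n. (\<Sum>i=1..n. X \<omega> - truncate (b i) (X \<omega>)) /\<^sub>R b n = f n \<omega>) sequentially"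
        using ev[of \<omega>] by (rule eventually_mono) (simp add: f_def truncate_def)
      ultimately show "(\<lambda>n. f n \<omega>) \<longlonglongrightarrow> 0" by (rule Lim_transform_eventually)
    qed
    show "AE \<omega> in M. norm (f n \<omega>) \<le> w \<omega>" for n
    proof (rule AE_I2)
      fix \<omega> assume \<omega>: "\<omega> \<in> space M"
      show "norm (f n \<omega>) \<le> w \<omega>"
      proof (cases "n = 0")
        case True
        then show ?thesis by (simp add: f_def w_def suminf_nonneg[OF summ])
      next
        case False
        then have bn: "0 < b n" using b(1) by simp
        \<comment> \<open>The truncations at \<open>b i\<close> and \<open>b n\<close> differ only
          when the norm of \<open>X\<close> lies in between, and then by a vector of norm at most
          \<open>b n\<close>. Level \<open>b i\<close> belongs to \<open>A (i - 1)\<close> because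
          of the shift in the definition of \<open>A\<close>.\<close>
        have "norm (\<Sum>i=1..n. truncate (b n) (X \<omega>) - truncate (b i) (X \<omega>)) \<le> (\<Sum>i=1..n. b n * indicat_real (A (i - 1)) \<omega>)"
        proof (rule sum_norm_le)
          fix i assume i: "i \<in> {1..n}"
          then have "b i \<le> b n" using b(2) by (auto simp: mono_on_def)
          then show "norm (truncate (b n) (X \<omega>) - truncate (b i) (X \<omega>)) \<le> b n * indicat_real (A (i - 1)) \<omega>"
            using i \<omega> bn by (auto simp: truncate_def A_def indicator_def)
        qed
        also have "\<dots> = b n * (\<Sum>i<n. indicat_real (A i) \<omega>)"
          unfolding sum_distrib_left
          by (rule sum.reindex_bij_witness[of _ Suc "\<lambda>i. i - 1"]) auto
        also have "\<dots> \<le> b n * w \<omega>"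
          unfolding w_def using bn summ by (intro mult_left_mono sum_le_suminf) auto
        finally show ?thesis using bn by (simp add: f_def field_simps)
      qed
    qed
  qed simp
  moreover have "eventually (\<lambda>n. expectation (f n) =
      (centering M X b n - (\<Sum>i=1..n. expectation (\<lambda>\<omega>. truncate (b i) (X \<omega>)))) /\<^sub>R b n) sequentially"
    using eventually_ge_at_top[of 1]
  proof eventually_elim
    case (elim n)
    have int: "integrable M (\<lambda>\<omega>. truncate (b i) (X \<omega>))" if "1 \<le> i" for i
      using b(1) that by (intro integrable_truncate X) (auto intro: less_imp_le)
    have "expectation (f n) = expectation (\<lambda>\<omega>. \<Sum>i=1..n. truncate (b n) (X \<omega>) - truncate (b i) (X \<omega>)) /\<^sub>R b n"
      unfolding f_def by simp
    also have "expectation (\<lambda>\<omega>. \<Sum>i=1..n. truncate (b n) (X \<omega>) - truncate (b i) (X \<omega>)) =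
        (\<Sum>i=1..n. expectation (\<lambda>\<omega>. truncate (b n) (X \<omega>)) - expectation (\<lambda>\<omega>. truncate (b i) (X \<omega>)))"
      using int elim by (subst Bochner_Integration.integral_sum) (auto intro!: sum.cong Bochner_Integration.integral_diff)
    also have "\<dots> = centering M X b n - (\<Sum>i=1..n. expectation (\<lambda>\<omega>. truncate (b i) (X \<omega>)))"
      by (simp add: sum_subtractf centering_eq_truncate sum_constant_scaleR)
    finally show ?case .
  qed
  ultimately show ?thesis by (simp add: Lim_transform_eventually)
qed

text \<open>With the first coordinate fixed, the truncated differences are independent and bounded
  in the second coordinate, so their normed sums tending to 0 implies the same for the means.
  Averaging replaces the independent copy by the constants \<open>\<mu> i\<close>, and truncation
  affects only finitely many terms on either factor.\<close>

lemma strong_law_centered: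
  fixes X :: "'w \<Rightarrow> 'b::{banach, second_countable_topology}"
  assumes iid: "iid_sequence M X Xs"
    and b: "\<forall>n\<ge>1. 0 < b n" "mono_on {1..} b" "filterlim b at_top sequentially"
    and fin: "tail_series M X b < \<infinity>"
    and lim: "AE z in M \<Otimes>\<^sub>M M. (\<lambda>n. partial_sum (\<lambda>i. symmetrization (Xs i)) n z /\<^sub>R b n) \<longlonglongrightarrow> 0"
  shows "AE \<omega> in M. (\<lambda>n. (partial_sum Xs n \<omega> - centering M X b n) /\<^sub>R b n) \<longlonglongrightarrow> 0"
proof -
  interpret prob_space M using iid by (simp add: iid_sequence_def)
  interpret PP: pair_prob_space M M ..
  have X[measurable]: "X \<in> borel_measurable M" using iid by (simp add: iid_sequence_def)
  have ind: "indep_vars (\<lambda>_. borel) Xs {1..}" using iid by (simp add: iid_sequence_def)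
  have rv: "Xs i \<in> borel_measurable M" if "1 \<le> i" for i
    using ind that by (auto simp: indep_vars_def)
  have ev: "AE \<omega> in M. eventually (\<lambda>i. norm (Xs i \<omega>) \<le> b i) sequentially"
    using rv iid fin by (intro AE_eventually_tail_series) (auto simp: iid_sequence_def)
  define \<mu> where "\<mu> i = expectation (\<lambda>\<omega>. truncate (b i) (X \<omega>))" for i
  have \<mu>: "expectation (\<lambda>\<omega>. truncate (b i) (Xs i \<omega>)) = \<mu> i" if "1 \<le> i" for i
  proof -
    have "expectation (\<lambda>\<omega>. truncate (b i) (Xs i \<omega>)) = (\<integral>x. truncate (b i) x \<partial>distr M borel (Xs i))"
      using rv[OF that] by (subst integral_distr) auto
    also have "\<dots> = (\<integral>x. truncate (b i) x \<partial>distr M borel X)"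
      using iid that by (simp add: iid_sequence_def)
    also have "\<dots> = \<mu> i" unfolding \<mu>_def by (subst integral_distr) auto
    finally show ?thesis .
  qed
  have "AE \<omega> in M. AE \<omega>' in M. (\<lambda>n. partial_sum (\<lambda>i. symmetrization (Xs i)) n (\<omega>, \<omega>') /\<^sub>R b n) \<longlonglongrightarrow> 0"
    using lim by (rule PP.AE_pair)
  with ev show ?thesis
  proof eventually_elim
    case (elim \<omega>)
    \<comment> \<open>Both terms are truncated, which provides the bound \<open>2 * b i\<close>
      needed for passing to means.\<close>
    define V where "V i \<omega>' = truncate (b i) (Xs i \<omega>) - truncate (b i) (Xs i \<omega>')" for i \<omega>'
    have "indep_vars (\<lambda>_. borel) V {1..}"
      unfolding V_def
      by (rule indep_vars_compose2[OF ind, where Y="\<lambda>i x. truncate (b i) (Xs i \<omega>) - truncate (b i) x"]) measurable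
    moreover have "norm (V i \<omega>') \<le> 2 * b i" if "1 \<le> i" for i \<omega>'
    proof -
      have "norm (truncate (b i) x) \<le> b i" for x :: 'b
        using b(1) that by (intro norm_truncate_le) (auto intro: less_imp_le)
      from norm_triangle_le_diff[OF add_mono[OF this this]] show ?thesis by (simp add: V_def)
    qed
    moreover have "AE \<omega>' in M. (\<lambda>n. partial_sum V n \<omega>' /\<^sub>R b n) \<longlonglongrightarrow> 0"
      using elim(2) ev
    proof eventually_elim
      case e: (elim \<omega>')
      have "eventually (\<lambda>i. V i \<omega>' = symmetrization (Xs i) (\<omega>, \<omega>')) sequentially"
        using e(2) elim(1) by eventually_elim (simp add: V_def truncate_def)
      from sum_tendsto_0_cong_eventually[OF this b(3)] e(1) show ?case by (simp add: partial_sum_def)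
    qed
    ultimately have "(\<lambda>n. (\<Sum>i=1..n. expectation (V i)) /\<^sub>R b n) \<longlonglongrightarrow> 0"
      by (rule expectation_partial_sum_tendsto_0[OF _ _ b])
    moreover have "expectation (V i) = truncate (b i) (Xs i \<omega>) - \<mu> i" if "1 \<le> i" for i
    proof -
      have "integrable M (\<lambda>\<omega>'. truncate (b i) (Xs i \<omega>'))"
        using b(1) that rv by (intro integrable_truncate) (auto intro: less_imp_le)
      then show ?thesis unfolding V_def using \<mu>[OF that] by (simp add: prob_space)
    qed
    then have "(\<Sum>i=1..n. expectation (V i)) = (\<Sum>i=1..n. truncate (b i) (Xs i \<omega>) - \<mu> i)" for n
      by (intro sum.cong) auto
    ultimately have lim': "(\<lambda>n. (\<Sum>i=1..n. truncate (b i) (Xs i \<omega>) - \<mu> i) /\<^sub>R b n) \<longlonglongrightarrow> 0" by simp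
    have "eventually (\<lambda>i. Xs i \<omega> - \<mu> i = truncate (b i) (Xs i \<omega>) - \<mu> i) sequentially"
      using elim(1) by eventually_elim (simp add: truncate_def)
    then have "(\<lambda>n. (\<Sum>i=1..n. Xs i \<omega> - \<mu> i) /\<^sub>R b n) \<longlonglongrightarrow> 0"
      by (rule sum_tendsto_0_cong_eventually[OF _ b(3) lim'])
    \<comment> \<open>The means truncated at their own levels \<open>b i\<close> are exchanged for
      the centering, which truncates all of them at \<open>b n\<close>.\<close>
    from tendsto_diff[OF this centering_minus_sum_tendsto_0[OF X b fin]] show ?case
      by (simp add: sum_subtractf partial_sum_def \<mu>_def scaleR_diff_right[symmetric])
  qed
qed

section \<open>The divergent case\<close>

text \<open>Were the symmetrized series finite at level \<open>K * b n\<close>, the symmetric law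
  would make the increments eventually at most \<open>b n / 2\<close>. The second Borel-Cantelli
  lemma would then give a finite series at that level, and desymmetrization a finite series for
  \<open>X\<close>. So it diverges for every \<open>K\<close>, and Borel-Cantelli applies
  again.\<close>

lemma symmetrization_increments_unbounded:
  fixes X :: "'w \<Rightarrow> 'b::{banach, second_countable_topology}"
  assumes iid: "iid_sequence M X Xs"
    and b: "\<forall>n\<ge>1. 0 < b n" "mono_on {1..} b" "filterlim b at_top sequentially"
    and law: "\<And>K. 0 < K \<Longrightarrow> tail_series (M \<Otimes>\<^sub>M M) (symmetrization X) (\<lambda>n. K * b n) < \<infinity> \<Longrightarrow>
      AE z in M \<Otimes>\<^sub>M M. (\<lambda>n. partial_sum (\<lambda>i. symmetrization (Xs i)) n z /\<^sub>R b n) \<longlonglongrightarrow> 0"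
    and inf: "tail_series M X b = \<infinity>" and K: "0 < K"
  shows "AE z in M \<Otimes>\<^sub>M M. \<exists>\<^sub>F n in sequentially. K * b n < norm (symmetrization (Xs n) z)"
proof -
  interpret prob_space M using iid by (simp add: iid_sequence_def)
  interpret PP: pair_prob_space M M ..
  define D where "D i = symmetrization (Xs i)" for i
  have X: "X \<in> borel_measurable M" using iid by (simp add: iid_sequence_def)
  have iidD: "iid_sequence (M \<Otimes>\<^sub>M M) (symmetrization X) D"
    unfolding D_def by (rule iid_sequence_symmetrization[OF iid])
  have indD: "PP.indep_vars (\<lambda>_. borel) (\<lambda>n. D (Suc n)) UNIV"
    using iidD by (intro PP.indep_vars_Suc) (simp add: iid_sequence_def)
  have freq: "AE z in M \<Otimes>\<^sub>M M. \<exists>\<^sub>F n in sequentially. t n < norm (D n z)"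
    if "tail_series (M \<Otimes>\<^sub>M M) (symmetrization X) t = \<infinity>" for t
  proof -
    have eq: "emeasure (M \<Otimes>\<^sub>M M) {z \<in> space (M \<Otimes>\<^sub>M M). t (Suc n) < norm (D (Suc n) z)} =
      emeasure (M \<Otimes>\<^sub>M M) {z \<in> space (M \<Otimes>\<^sub>M M). t (Suc n) < norm (symmetrization X z)}" for n
      using iidD by (intro emeasure_norm_gt_cong) (auto simp: iid_sequence_def PP.indep_vars_def)
    have "AE z in M \<Otimes>\<^sub>M M. \<exists>\<^sub>F n in sequentially. t (Suc n) < norm (D (Suc n) z)"
      by (rule PP.borel_cantelli_second[OF indD, where P="\<lambda>n x. t (Suc n) < norm x"])
        (use that in \<open>auto simp: eq tail_series_def\<close>)
    then show ?thesis
      by eventually_elim (simp add: frequently_def eventually_sequentially_Suc[where P="\<lambda>n. \<not> t n < norm (D n z)" for z])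
  qed
  have "tail_series (M \<Otimes>\<^sub>M M) (symmetrization X) (\<lambda>n. K * b n) = \<infinity>"
  proof (rule ccontr)
    assume "tail_series (M \<Otimes>\<^sub>M M) (symmetrization X) (\<lambda>n. K * b n) \<noteq> \<infinity>"
    then have "AE z in M \<Otimes>\<^sub>M M. (\<lambda>n. partial_sum D n z /\<^sub>R b n) \<longlonglongrightarrow> 0"
      unfolding D_def by (intro law[OF K]) (simp add: less_top)
    then have small: "AE z in M \<Otimes>\<^sub>M M. \<not> (\<exists>\<^sub>F n in sequentially. b n / 2 < norm (D n z))"
    proof eventually_elim
      case (elim z)
      \<comment> \<open>An increment is the difference of two consecutive sums, so a quarter for
        each sum gives one half.\<close>
      have "eventually (\<lambda>n. \<forall>k\<le>n. norm (partial_sum D k z) \<le> 1 / 4 * b n) sequentially"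
        by (rule tendsto_imp_eventually_max_le[OF elim _ b]) simp
      then have "eventually (\<lambda>n. \<not> b n / 2 < norm (D n z)) sequentially"
        using eventually_ge_at_top[of 1]
      proof eventually_elim
        case (elim n)
        then obtain m where n: "n = Suc m" by (cases n) auto
        have "norm (D n z) = norm (partial_sum D n z - partial_sum D m z)" by (simp add: n)
        also have "\<dots> \<le> norm (partial_sum D n z) + norm (partial_sum D m z)" by (rule norm_triangle_ineq4)
        also have "\<dots> \<le> 1 / 4 * b n + 1 / 4 * b n" using elim n by (intro add_mono) auto
        finally show ?case by simp
      qed
      then show ?case by (simp add: frequently_def)
    qed
    have "tail_series (M \<Otimes>\<^sub>M M) (symmetrization X) (\<lambda>n. b n / 2) < \<infinity>"
    proof (rule ccontr)
      assume "\<not> tail_series (M \<Otimes>\<^sub>M M) (symmetrization X) (\<lambda>n. b n / 2) < \<infinity>"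
      with freq[of "\<lambda>n. b n / 2"] have "AE z in M \<Otimes>\<^sub>M M. \<exists>\<^sub>F n in sequentially. b n / 2 < norm (D n z)"
        by (simp add: less_top[symmetric])
      with small have "AE z in M \<Otimes>\<^sub>M M. False" by eventually_elim simp
      then show False by simp
    qed
    from tail_series_finite_of_symmetrization[OF X b(3) this] inf show False by simp
  qed
  from freq[OF this] show ?thesis by (simp add: D_def)
qed

lemma limsup_ereal_eq_top:
  fixes x :: "nat \<Rightarrow> real"
  assumes "\<And>C. \<not> eventually (\<lambda>n. x n \<le> C) sequentially"
  shows "limsup (\<lambda>n. ereal (x n)) = \<infinity>"
proof (rule ccontr)
  assume "limsup (\<lambda>n. ereal (x n)) \<noteq> \<infinity>"
  then obtain C :: nat where "limsup (\<lambda>n. ereal (x n)) < ereal (real C)"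
    using less_PInf_Ex_of_nat[of "limsup (\<lambda>n. ereal (x n))"] by auto
  then have "eventually (\<lambda>n. ereal (x n) < ereal (real C)) sequentially" by (rule Limsup_lessD)
  then have "eventually (\<lambda>n. x n \<le> real C) sequentially" by (rule eventually_mono) simp
  with assms show False by blast
qed

text \<open>If the centered sums were \<open>O(b n)\<close> at both coordinates,
  \<open>\<gamma> n\<close> would cancel in the difference and the symmetrized increments would be
  \<open>O(b n)\<close> too. Hence almost no pair has both coordinates in \<open>E\<close>, for any
  centering.\<close>

lemma limsup_centered_eq_top:
  fixes Xs :: "nat \<Rightarrow> 'w \<Rightarrow> 'b::real_normed_vector"
  assumes M: "prob_space M"
    and b: "\<forall>n\<ge>1. 0 < b n" "mono_on {1..} b"
    and unbounded: "\<And>K. 0 < K \<Longrightarrow>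
      AE z in M \<Otimes>\<^sub>M M. \<exists>\<^sub>F n in sequentially. K * b n < norm (symmetrization (Xs n) z)"
  shows "AE \<omega> in M. limsup (\<lambda>n. ereal (norm (partial_sum Xs n \<omega> - \<gamma> n) / b n)) = \<infinity>"
proof -
  interpret prob_space M by (rule M)
  interpret PP: pair_prob_space M M ..
  define E where "E \<omega> \<longleftrightarrow> (\<exists>C. eventually (\<lambda>n. norm (partial_sum Xs n \<omega> - \<gamma> n) \<le> C * b n) sequentially)" for \<omega>
  have incr: "eventually (\<lambda>n. norm (symmetrization (Xs n) (\<omega>, \<omega>')) \<le> 2 * (C + C') * b n) sequentially"
    if C: "eventually (\<lambda>n. norm (partial_sum Xs n \<omega> - \<gamma> n) \<le> C * b n) sequentially"
      and C': "eventually (\<lambda>n. norm (partial_sum Xs n \<omega>' - \<gamma> n) \<le> C' * b n) sequentially" for \<omega> \<omega>' C C'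
  proof -
    define T where "T n = partial_sum Xs n \<omega> - partial_sum Xs n \<omega>'" for n
    have "eventually (\<lambda>n. norm (T n) \<le> (C + C') * b n) sequentially"
      using C C'
    proof eventually_elim
      case (elim n)
      have "norm (T n) \<le> norm (partial_sum Xs n \<omega> - \<gamma> n) + norm (partial_sum Xs n \<omega>' - \<gamma> n)"
        unfolding T_def by (metis diff_diff_eq2 diff_add_cancel norm_triangle_ineq4 diff_add_eq add_diff_cancel_right)
      also have "\<dots> \<le> C * b n + C' * b n" using elim by (intro add_mono)
      finally show ?case by (simp add: algebra_simps)
    qed
    then obtain m where m: "\<And>n. m \<le> n \<Longrightarrow> norm (T n) \<le> (C + C') * b n"
      by (auto simp: eventually_sequentially)
    show ?thesis
      \<comment> \<open>The offset puts the predecessor \<open>k\<close> of \<open>n\<close> at or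
        beyond both \<open>m\<close> and 1, where the bound on \<open>T k\<close> and the positivity
        of \<open>b k\<close> hold.\<close>
      using eventually_ge_at_top[of "m + 2"]
    proof eventually_elim
      case (elim n)
      then obtain k where n: "n = Suc k" and k: "1 \<le> k" "m \<le> k" by (cases n) auto
      have CC: "0 \<le> C + C'"
        using order_trans[OF norm_ge_zero m[OF k(2)]] b(1)[rule_format, OF k(1)] by (auto simp: zero_le_mult_iff)
      have "norm (symmetrization (Xs n) (\<omega>, \<omega>')) = norm (T n - T k)" by (simp add: T_def n algebra_simps)
      also have "\<dots> \<le> norm (T n) + norm (T k)" by (rule norm_triangle_ineq4)
      also have "\<dots> \<le> (C + C') * b n + (C + C') * b k" using m[of n] m[of k] k n by (intro add_mono) auto
      also have "(C + C') * b k \<le> (C + C') * b n"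
        using CC b(2) k n by (intro mult_left_mono) (auto simp: mono_on_def)
      finally show ?case by (simp add: algebra_simps)
    qed
  qed
  \<comment> \<open>Integer factors suffice to exclude every constant and keep the exceptional null
    sets countable in number; adding 1 keeps the factor positive.\<close>
  have "AE z in M \<Otimes>\<^sub>M M. \<forall>K::nat. \<exists>\<^sub>F n in sequentially. (1 + real K) * b n < norm (symmetrization (Xs n) z)"
    by (subst AE_all_countable) (intro allI unbounded, simp)
  then have "AE z in M \<Otimes>\<^sub>M M. \<not> (E (fst z) \<and> E (snd z))"
  proof eventually_elim
    case (elim z)
    show ?case
    proof
      assume "E (fst z) \<and> E (snd z)"
      then obtain C where C: "eventually (\<lambda>n. norm (symmetrization (Xs n) z) \<le> C * b n) sequentially"
        using incr[of "fst z" _ "snd z"] unfolding E_def by fastforce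
      obtain K :: nat where K: "C \<le> real K" using real_arch_simple by blast
      have "eventually (\<lambda>n. \<not> (1 + real K) * b n < norm (symmetrization (Xs n) z)) sequentially"
        using C eventually_ge_at_top[of 1]
      proof eventually_elim
        case (elim n)
        have "C * b n \<le> (1 + real K) * b n" using K b(1) elim by (intro mult_right_mono) (auto intro: less_imp_le)
        then show ?case using elim by linarith
      qed
      with elim show False by (auto simp: frequently_def)
    qed
  qed
  from PP.AE_pair[OF this] have EE: "AE \<omega> in M. AE \<omega>' in M. \<not> (E \<omega> \<and> E \<omega>')" by simp
  have "AE \<omega> in M. \<not> E \<omega>"
  proof (cases "\<exists>\<omega>. E \<omega> \<and> (AE \<omega>' in M. \<not> (E \<omega> \<and> E \<omega>'))")
    case True
    then obtain \<omega> where "E \<omega>" "AE \<omega>' in M. \<not> (E \<omega> \<and> E \<omega>')" by blast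
    then show ?thesis by simp
  next
    case False
    then have "\<not> E \<omega>" if "AE \<omega>' in M. \<not> (E \<omega> \<and> E \<omega>')" for \<omega> using that by blast
    with EE show ?thesis by (rule eventually_mono)
  qed
  then show ?thesis
  proof eventually_elim
    case (elim \<omega>)
    show ?case
    proof (rule limsup_ereal_eq_top)
      fix C
      show "\<not> eventually (\<lambda>n. norm (partial_sum Xs n \<omega> - \<gamma> n) / b n \<le> C) sequentially"
      proof
        assume "eventually (\<lambda>n. norm (partial_sum Xs n \<omega> - \<gamma> n) / b n \<le> C) sequentially"
        then have "eventually (\<lambda>n. norm (partial_sum Xs n \<omega> - \<gamma> n) \<le> C * b n) sequentially"
          using eventually_ge_at_top[of 1] by eventually_elim (use b(1) in \<open>simp add: field_simps\<close>)
        with elim show False by (auto simp: E_def)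
      qed
    qed
  qed
qed

theorem theorem1p2:
  fixes a b :: "nat \<Rightarrow> real"
    and M :: "'w measure"
    and X :: "'w \<Rightarrow> 'b::{banach, second_countable_topology}"
    and Xs :: "nat \<Rightarrow> 'w \<Rightarrow> 'b"
  assumes "\<forall>n\<ge>1. a n > 0" and "\<forall>n\<ge>1. b n > 0"
    and "strict_mono_on {1..} a" and "strict_mono_on {1..} b"
    and "filterlim a at_top sequentially"
    and "mono_on {1..} (\<lambda>n. b n / a n)"
    and "symmetric_strong_law TYPE('b) a"
    and "iid_sequence M X Xs"
  shows "(tail_series M X b < \<infinity> \<longrightarrow>
            (AE \<omega> in M. (\<lambda>n. (partial_sum Xs n \<omega> - centering M X b n) /\<^sub>R b n) \<longlonglongrightarrow> 0)) \<and>
         (tail_series M X b = \<infinity> \<longrightarrow>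
            (AE \<omega> in M. limsup (\<lambda>n. ereal (norm (partial_sum Xs n \<omega> - centering M X b n) / b n)) = \<infinity>))"
proof -
  note iid = assms(8)
  interpret prob_space M using iid by (simp add: iid_sequence_def)
  have X: "X \<in> borel_measurable M" using iid by (simp add: iid_sequence_def)
  have mono: "mono_on {1..} a" "mono_on {1..} b"
    using assms(3,4) by (auto intro: strict_mono_on_imp_mono_on)
  \<comment> \<open>Since \<open>b n / a n\<close> is nondecreasing, \<open>b n\<close> dominates
    the fixed multiple \<open>b 1 / a 1\<close> of \<open>a n\<close>.\<close>
  have b_top: "filterlim b at_top sequentially"
  proof (rule filterlim_at_top_mono)
    show "filterlim (\<lambda>n. b 1 / a 1 * a n) at_top sequentially"
      using assms(1,2,5) by (intro filterlim_tendsto_pos_mult_at_top[OF tendsto_const]) auto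
    show "eventually (\<lambda>n. b 1 / a 1 * a n \<le> b n) sequentially"
      using eventually_ge_at_top[of 1]
    proof eventually_elim
      case (elim n)
      then have "b 1 / a 1 \<le> b n / a n" using assms(6) by (auto simp: mono_on_def)
      moreover have "0 < a n" using assms(1) elim by simp
      ultimately show ?case by (simp add: pos_le_divide_eq)
    qed
  qed
  note b = assms(2) mono(2) b_top
  \<comment> \<open>Stated for every multiple of \<open>b\<close>: the convergent case uses
    \<open>K = 2\<close>, coming from the symmetrized tail bound, and the divergent case all
    \<open>K > 0\<close>. Norming by \<open>K * b n\<close> or by \<open>b n\<close> gives the same
    limit 0.\<close>
  have law: "AE z in M \<Otimes>\<^sub>M M. (\<lambda>n. partial_sum (\<lambda>i. symmetrization (Xs i)) n z /\<^sub>R b n) \<longlonglongrightarrow> 0"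
    if K: "0 < K" and fin: "tail_series (M \<Otimes>\<^sub>M M) (symmetrization X) (\<lambda>n. K * b n) < \<infinity>" for K
  proof -
    have "AE z in M \<Otimes>\<^sub>M M. (\<lambda>n. partial_sum (\<lambda>i. symmetrization (Xs i)) n z /\<^sub>R (K * b n)) \<longlonglongrightarrow> 0"
    proof (rule symmetric_strong_law_mono[OF assms(7,1) mono(1) assms(5) _ _ _ _ _ fin])
      show "\<forall>n\<ge>1. 0 < K * b n" using K assms(2) by simp
      show "mono_on {1..} (\<lambda>n. K * b n / a n)"
        using assms(6) K by (auto simp: mono_on_def times_divide_eq_right[symmetric] simp del: times_divide_eq_right)
      show "filterlim (\<lambda>n. K * b n) at_top sequentially"
        using K b_top by (intro filterlim_tendsto_pos_mult_at_top[OF tendsto_const])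
      show "iid_sequence (M \<Otimes>\<^sub>M M) (symmetrization X) (\<lambda>i. symmetrization (Xs i))"
        by (rule iid_sequence_symmetrization[OF iid])
      show "symmetric_rv (M \<Otimes>\<^sub>M M) (symmetrization X)"
        by (rule symmetric_rv_symmetrization[OF X])
    qed
    then show ?thesis
    proof eventually_elim
      case (elim z)
      from tendsto_scaleR[OF tendsto_const[of K] elim] K show ?case
        by (simp add: mult.assoc[symmetric])
    qed
  qed
  show ?thesis
  proof (intro conjI impI)
    assume fin: "tail_series M X b < \<infinity>"
    show "AE \<omega> in M. (\<lambda>n. (partial_sum Xs n \<omega> - centering M X b n) /\<^sub>R b n) \<longlonglongrightarrow> 0"
      by (rule strong_law_centered[OF iid b fin law[OF _ tail_series_symmetrization_finite[OF X fin]]]) simp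
  next
    assume inf: "tail_series M X b = \<infinity>"
    show "AE \<omega> in M. limsup (\<lambda>n. ereal (norm (partial_sum Xs n \<omega> - centering M X b n) / b n)) = \<infinity>"
      by (rule limsup_centered_eq_top[OF prob_space_axioms b(1,2)])
        (rule symmetrization_increments_unbounded[OF iid b law inf])
  qed
qed

end
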